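(* Let $r$ be a positive integer, $m\ge 0$ an integer, and let $\lambda=(\lambda_1,\dots,\lambda_\ell)$ be a partition whose conjugate $\mu=\lambda^t=(\mu_1,\dots,\mu_{\lambda_1})$ satisfies $\mu_{\lambda_1}>r$. Put $n=\lambda_{r+1}+\cdots+\lambda_\ell$ and $\lambda'=(\lambda_1+m,\dots,\lambda_r+m,\lambda_{r+1},\dots,\lambda_\ell)$. Then the local map $$\psi^{(r)}: \mathcal{S}(n,m)\times\mathcal{M}(\lambda)\to\mathcal{M}(\lambda')$$ is a bijection.
   Context: Motzkin paths. A Motzkin path of length $n$ is a lattice path from $(0,0)$ to $(n,0)$ with steps $U=(1,1)$, $H=(1,0)$, $D=(1,-1)$ staying weakly above the $x$-axis; $\mathcal{M}(n)$ is the set of these. $\oplus$ denotes concatenation of paths. A block is either a single $H$ step on its base line, or a sequence of steps starting with a $U$ step from the base line and ending with the first $D$ step returning to the base line afterwards (the base line is the $x$-axis unless stated otherwise). The unit Motzkin path $u^{(j)}$ of length $j\ge1$ is $U^{j/2}D^{j/2}$ if $j$ is even and $U^{(j-1)/2}HD^{(j-1)/2}$ if $j$ is odd. A unital segment of a Motzkin path is a maximal sequence of consecutive steps forming a unit Motzkin path (up to translation; it need not start on the $x$-axis). For a path $p$ with maximal height $y(p)$ (measured relative to its base line, or equivalently in absolute coordinates when comparing blocks on the same base line), $\mathsf{ht}(p)=y(p)+\frac12$ if $p$ has an $H$ step at the maximal height, and $\mathsf{ht}(p)=y(p)$ otherwise. Shape algorithm. Given $p\in\mathcal{M}(n)$,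 set $\overline p=p$. (1) Let $\overline p=p_1\oplus\cdots\oplus p_s$ be the decomposition into blocks. If all $p_i$ are unit Motzkin paths go to (3), else go to (2). (2) Let $i$ be least such that $p_i$ is not a unit Motzkin path. Let $M$ be the greatest integer such that $p_i=U^M\oplus q_1\oplus\cdots\oplus q_k\oplus D^M$ with each $q_j$ a block with base line $y=M$. Let $t$ be the least index for which $\mathsf{ht}(q_t)$ is maximal among $\mathsf{ht}(q_1),\dots,\mathsf{ht}(q_k)$. Replace $p_i$ in $\overline p$ by $p_i'=q_1\oplus\cdots\oplus q_{t-1}\oplus U^M\oplus q_t\oplus D^M\oplus q_{t+1}\oplus\cdots\oplus q_k$ and return to (1). (3) Set $p_{\mathsf{min}}=\overline p$; let $\mu$ be the partition of $n$ formed by the lengths of $p_1,\dots,p_s$ in decreasing order, and let $\theta(p)=\mu^t$ be its conjugate. $p$ has shape $\lambda$ if $\theta(p)=\lambda$, and $\mathcal{M}(\lambda)$ is the set of Motzkin paths of shape $\lambda$. $\mathcal{S}(n,m)=\{(a_1,\dots,a_m): 0\le a_1\le\cdots\le a_m\le n\}$, a set of integer sequences ($\mathcal{S}(n,0)$ contains only the empty sequence). The map $\psi^{(r)}$. Given $\alpha=(a_1,\dots,a_m)\in\mathcal{S}(n,m)$ and $p\in\mathcal{M}(\lambda)$: (i) for each unital segment of $p$, mark $r$ of its lattice points, processed from top to bottom, and, when two candidate points lie at the same height, marking the left one first; (ii) label all unmarked lattice points of $p$ by $0,1,\dots,n$ from right to left; (iii) for each $i=1,\dots,m$ insert a copy of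 $u^{(r)}$ at the point labeled $a_i$, so that the right endpoint of the inserted $u^{(r)}$ then carries the label $a_i$. The resulting path is $\psi^{(r)}(\alpha,p)$. For $m=0$, $\psi^{(r)}$ is the identity. *)

theory Defs
  imports Complex_Main
begin

text \<open>
  A lattice path is the list of its steps; its lattice points are numbered \<open>0, \<dots>, length p\<close>
  from left to right, and all heights are relative to the starting point. Hence a step list may be
  read on any base line, and \<open>\<oplus>\<close> is list append.
\<close>

datatype step = U | H | D

type_synonym path = "step list"

primrec rise :: "step \<Rightarrow> int" where
  "rise U = 1"
| "rise H = 0"
| "rise D = -1"

definition height :: "path \<Rightarrow> nat \<Rightarrow> int" where
  "height p k = (\<Sum>i<k. rise (p ! i))"

definition motzkin :: "path \<Rightarrow> bool" where
  "motzkin p \<longleftrightarrow> (\<forall>k\<le>length p. 0 \<le> height p k) \<and> height p (length p) = 0"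

text \<open>In the second case the last step is necessarily the first \<open>D\<close> returning to the base line.\<close>

definition is_block :: "path \<Rightarrow> bool" where
  "is_block b \<longleftrightarrow> b = [H] \<or>
     (b \<noteq> [] \<and> hd b = U \<and> height b (length b) = 0 \<and> (\<forall>k. 0 < k \<and> k < length b \<longrightarrow> 0 < height b k))"

definition unit_path :: "nat \<Rightarrow> path" where
  "unit_path j = replicate (j div 2) U @ (if even j then [] else [H]) @ replicate (j div 2) D"

definition is_unit_path :: "path \<Rightarrow> bool" where
  "is_unit_path p \<longleftrightarrow> (\<exists>j\<ge>1. p = unit_path j)"

definition max_height :: "path \<Rightarrow> int" where
  "max_height p = Max (height p ` {..length p})"

definition ht :: "path \<Rightarrow> rat" where
  "ht p = of_int (max_height p) +
     (if \<exists>k<length p. p ! k = H \<and> height p k = max_height p then 1 / 2 else 0)"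

text \<open>
  One pass through step (2) of the shape algorithm: \<open>ps\<close> are the blocks before the first non-unit
  block \<open>b\<close>, and \<open>rs\<close> the blocks after it. The decomposition of a path into blocks is unique, so a
  path has at most one successor.
\<close>

inductive shape_step :: "path \<Rightarrow> path \<Rightarrow> bool" where
  "\<lbrakk> \<forall>x \<in> set ps. is_block x \<and> is_unit_path x;
     is_block b; \<not> is_unit_path b;
     \<forall>x \<in> set rs. is_block x;
     b = replicate M U @ concat qs @ replicate M D; \<forall>q \<in> set qs. is_block q;
     \<And>M' qs'. \<lbrakk> b = replicate M' U @ concat qs' @ replicate M' D; \<forall>q \<in> set qs'. is_block q \<rbrakk>
        \<Longrightarrow> M' \<le> M;
     t < length qs;
     \<forall>j<length qs. ht (qs ! j) \<le> ht (qs ! t);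
     \<forall>j<t. ht (qs ! j) < ht (qs ! t) \<rbrakk>
   \<Longrightarrow> shape_step (concat ps @ b @ concat rs)
        (concat ps @
         (concat (take t qs) @ replicate M U @ qs ! t @ replicate M D @ concat (drop (Suc t) qs)) @
         concat rs)"

text \<open>Partitions are weakly decreasing lists of positive parts.\<close>

definition is_partition :: "nat list \<Rightarrow> bool" where
  "is_partition lam \<longleftrightarrow> sorted_wrt (\<ge>) lam \<and> (\<forall>x \<in> set lam. 0 < x)"

definition conjugate :: "nat list \<Rightarrow> nat list" where
  "conjugate lam = (case lam of [] \<Rightarrow> []
     | x # _ \<Rightarrow> map (\<lambda>i. length (filter (\<lambda>y. i \<le> y) lam)) [1..<Suc x])"

text \<open>\<open>bs\<close> is the block decomposition of the path on which the shape algorithm stops.\<close>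

definition has_shape :: "path \<Rightarrow> nat list \<Rightarrow> bool" where
  "has_shape p lam \<longleftrightarrow>
     (\<exists>bs. shape_step\<^sup>*\<^sup>* p (concat bs) \<and> (\<forall>b \<in> set bs. is_block b \<and> is_unit_path b) \<and>
           lam = conjugate (rev (sort (map length bs))))"

definition motzkin_of_shape :: "nat list \<Rightarrow> path set" where
  "motzkin_of_shape lam = {p. motzkin p \<and> has_shape p lam}"

definition seqs :: "nat \<Rightarrow> nat \<Rightarrow> nat list set" where
  "seqs n m = {as. length as = m \<and> sorted as \<and> (\<forall>a \<in> set as. a \<le> n)}"

text \<open>A segment is given by its starting point \<open>i\<close> and its number of steps \<open>j\<close>.\<close>

definition unit_segment :: "path \<Rightarrow> nat \<Rightarrow> nat \<Rightarrow> bool" where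
  "unit_segment p i j \<longleftrightarrow> 1 \<le> j \<and> i + j \<le> length p \<and> take j (drop i p) = unit_path j"

definition unital_segment :: "path \<Rightarrow> nat \<Rightarrow> nat \<Rightarrow> bool" where
  "unital_segment p i j \<longleftrightarrow> unit_segment p i j \<and>
     (\<forall>i' j'. unit_segment p i' j' \<and> i' \<le> i \<and> i + j \<le> i' + j' \<longrightarrow> i' = i \<and> j' = j)"

text \<open>\<open>sort_key\<close> is stable, so points of equal height remain ordered from left to right.\<close>

definition marked :: "nat \<Rightarrow> path \<Rightarrow> nat set" where
  "marked r p =
     {k. \<exists>i j. unital_segment p i j \<and> k \<in> set (take r (sort_key (\<lambda>x. - height p x) [i..<Suc (i + j)]))}"

text \<open>The point labeled \<open>a\<close> is \<open>labeled_points r p ! a\<close>.\<close>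

definition labeled_points :: "nat \<Rightarrow> path \<Rightarrow> nat list" where
  "labeled_points r p = rev (filter (\<lambda>k. k \<notin> marked r p) [0..<Suc (length p)])"

text \<open>
  Inserting at the point \<open>pos ! a\<close> shifts that point, and every point to its right, so that the
  label \<open>a\<close> moves to the right endpoint of the inserted unit path.
\<close>

definition insert_unit :: "nat \<Rightarrow> nat \<Rightarrow> path \<times> nat list \<Rightarrow> path \<times> nat list" where
  "insert_unit r a = (\<lambda>(p, pos).
     (take (pos ! a) p @ unit_path r @ drop (pos ! a) p,
      map (\<lambda>k. if k < pos ! a then k else k + r) pos))"

definition psi :: "nat \<Rightarrow> nat list \<times> path \<Rightarrow> path" where
  "psi r = (\<lambda>(as, p). fst (fold (insert_unit r) as (p, labeled_points r p)))"

end

theory Submission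
  imports Defs "HOL-Library.Multiset"
begin

text \<open>
  The shape algorithm only matters through the multiset of block lengths on which it stops.
  This multiset is additive under concatenation, and the passage from \<open>p\<close> to \<open>UpD\<close> raises one
  largest part by 2. Thus a path has shape \<open>\<lambda>\<close> iff its parts form the conjugate of \<open>\<lambda>\<close>.

  A path all of whose parts are at least \<open>r\<close> factors uniquely into tokens: \<open>U\<close>, \<open>D\<close>, \<open>u\<^sup>(\<^sup>r\<^sup>)\<close>,
  \<open>u\<^sup>(\<^sup>r\<^sup>+\<^sup>1\<^sup>)\<close> and \<open>U u\<^sup>(\<^sup>r\<^sup>)\<close>. The last one occurs where all blocks on a base line equal \<open>u\<^sup>(\<^sup>r\<^sup>)\<close>; there
  the first of them supports the surrounding block and cannot be removed. The tokens
  \<open>u\<^sup>(\<^sup>r\<^sup>)\<close> account exactly for the parts equal to \<open>r\<close>, and they may be deleted or inserted at any gap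
  between tokens. In a path without them, the gaps are exactly the unmarked points, so \<open>\<psi>\<close> inserts
  tokens \<open>u\<^sup>(\<^sup>r\<^sup>)\<close> into a word, which is plainly reversible.
\<close>

subsection \<open>Motzkin paths and their blocks\<close>

text \<open>One maximal inner block absorbs the surrounding \<open>U^M\<close> and
  \<open>D^M\<close> because \<open>ht\<close> is half of the largest part: a layer adds 1 to
  \<open>ht\<close> and 2 to that part. In a multiset ties between equal parts disappear, so the
  outcome of the algorithm can be computed by one fold over the path.

  That the last entry of the conjugate exceeds r means that every part of a path of shape \<lambda>
  exceeds r, so its word has no token u^(r). Passing to \<lambda>' appends m columns of height r,
  that is, m such tokens. The bound n is forced: each part costs r steps beyond the number of tokens
  that produce it, so a path with \<lambda>_1 parts has |\<lambda>| - r \<lambda>_1 tokens, which is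
  n because the first r rows of \<lambda> are equal.

  The delicate point is unambiguity. A base line carrying only copies of u^(r) gives up one of them
  to the surrounding block; since equal heights are marked from the left, it is the first copy that
  must be tied to its \<open>U\<close>.\<close>

lemma height_0 [simp]: "height p 0 = 0"
  by (simp add: height_def)

lemma height_Cons [simp]: "height (s # p) (Suc k) = rise s + height p k"
  by (simp add: height_def sum.lessThan_Suc_shift del: sum.lessThan_Suc)

lemma height_append_left: "k \<le> length p \<Longrightarrow> height (p @ q) k = height p k"
  by (auto simp: height_def nth_append intro!: sum.cong)

lemma height_append_right [simp]:
  "height (p @ q) (length p + k) = height p (length p) + height q k"
  by (induction p) auto

lemma height_append_length [simp]: "height (p @ q) (length p) = height p (length p)"
  by (simp add: height_append_left)

text \<open>The first-return decomposition as a grammar; unlike the height condition in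
  \<open>motzkin\<close> it supports structural induction.\<close>

inductive mot :: "path \<Rightarrow> bool" where
  Nil: "mot []"
| H: "mot p \<Longrightarrow> mot (H # p)"
| U: "mot p \<Longrightarrow> mot q \<Longrightarrow> mot (U # p @ D # q)"

lemma mot_height_length [simp]: "mot p \<Longrightarrow> height p (length p) = 0"
proof (induction rule: mot.induct)
  case (U p q)
  have "height (U # p @ D # q) (Suc (length p + Suc (length q))) = 0"
    using U by (simp only: height_Cons height_append_right) simp
  then show ?case by simp
qed auto

lemma mot_height_nonneg: "mot p \<Longrightarrow> k \<le> length p \<Longrightarrow> 0 \<le> height p k"
proof (induction arbitrary: k rule: mot.induct)
  case (H p)
  then show ?case by (cases k) auto
next
  case (U p q)
  show ?case
  proof (cases "k \<le> Suc (length p)")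
    case True
    then show ?thesis using U.IH(1)[of "k - 1"]
      by (cases k) (auto simp: height_append_left)
  next
    case False
    then obtain l where l: "k = Suc (length p + Suc l)"
      using that[of "k - length p - 2"] by simp
    then have "height (U # p @ D # q) k = height q l"
      using U.hyps by (simp only: height_Cons height_append_right) simp
    then show ?thesis using U.IH(2)[of l] U.prems l by simp
  qed
qed auto

text \<open>Cut at the first step below the base line. After a leading \<open>U\<close> the rest
  ends below -1, so two descents follow each other: the first closes the \<open>U\<close>, the
  second is the one sought.\<close>

lemma first_descent:
  "height p (length p) < 0 \<Longrightarrow> \<exists>x y. p = x @ D # y \<and> mot x"
proof (induction "length p" arbitrary: p rule: less_induct)
  case less
  show ?case
  proof (cases p)
    case Nil
    then show ?thesis using less.prems by simp
  next
    case (Cons s q)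
    show ?thesis
    proof (cases s)
      case D
      then show ?thesis using Cons mot.Nil by (metis append_Nil)
    next
      case H
      with Cons less.prems have "height q (length q) < 0" by simp
      with less.hyps[of q] Cons obtain x y where "q = x @ D # y" "mot x" by auto
      then show ?thesis using Cons H mot.H by (metis append_Cons)
    next
      case U
      with Cons less.prems have "height q (length q) < -1" by simp
      with less.hyps[of q] Cons obtain x y where q: "q = x @ D # y" "mot x" by auto
      have "height q (length x + Suc (length y)) = height y (length y) - 1"
        using q by (simp only: height_append_right) simp
      with \<open>height q (length q) < -1\<close> q have "height y (length y) < 0" by simp
      with less.hyps[of y] Cons q obtain x' y' where y: "y = x' @ D # y'" "mot x'" by auto
      then have "p = (U # x @ D # x') @ D # y'" "mot (U # x @ D # x')"
        using q y Cons U mot.U by auto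
      then show ?thesis by blast
    qed
  qed
qed

lemma motzkin_iff_mot: "motzkin p \<longleftrightarrow> mot p"
proof
  show "mot p" if "motzkin p"
    using that
  proof (induction "length p" arbitrary: p rule: less_induct)
    case less
    have nn: "\<And>k. k \<le> length p \<Longrightarrow> 0 \<le> height p k" and z: "height p (length p) = 0"
      using less.prems by (auto simp: motzkin_def)
    show ?case
    proof (cases p)
      case Nil
      then show ?thesis by (simp add: mot.Nil)
    next
      case (Cons s q)
      show ?thesis
      proof (cases s)
        case D
        then show ?thesis using nn[of 1] Cons by simp
      next
        case H
        have "motzkin q"
          unfolding motzkin_def using nn[of "Suc _"] z Cons H by auto
        then show ?thesis using less.hyps[of q] Cons H by (simp add: mot.H)
      next
        case U
        with z Cons have "height q (length q) < 0" by simp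
        then obtain x y where q: "q = x @ D # y" "mot x" using first_descent by blast
        have *: "height p (Suc (length x + Suc k)) = height y k" for k
          using q Cons U by (simp only: height_Cons height_append_right) simp
        have "motzkin y"
          unfolding motzkin_def
        proof (intro conjI allI impI)
          show "0 \<le> height y k" if "k \<le> length y" for k
            using nn[of "Suc (length x + Suc k)"] *[of k] that q Cons by simp
          show "height y (length y) = 0"
            using z *[of "length y"] q Cons by simp
        qed
        then have "mot y" using less.hyps[of y] Cons q by simp
        then show ?thesis using q Cons U by (simp add: mot.U)
      qed
    qed
  qed
next
  show "motzkin p" if "mot p"
    using that mot_height_nonneg unfolding motzkin_def by simp
qed

lemma mot_append: "mot p \<Longrightarrow> mot q \<Longrightarrow> mot (p @ q)"
proof (induction rule: mot.induct)
  case (U p p')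
  then have "mot (U # p @ D # (p' @ q))" by (intro mot.U)
  then show ?case by simp
qed (simp_all add: mot.H)

lemma mot_block: "mot x \<Longrightarrow> mot (U # x @ [D])"
  using mot.U[OF _ mot.Nil] by simp

lemma is_block_iff: "is_block b \<longleftrightarrow> b = [H] \<or> (\<exists>x. mot x \<and> b = U # x @ [D])"
proof
  assume b: "is_block b"
  show "b = [H] \<or> (\<exists>x. mot x \<and> b = U # x @ [D])"
  proof (cases "b = [H]")
    case False
    with b obtain q where q: "b = U # q" and z: "height b (length b) = 0"
      and pos: "\<And>k. 0 < k \<Longrightarrow> k < length b \<Longrightarrow> 0 < height b k"
      unfolding is_block_def by (cases b) auto
    then have "height q (length q) < 0" by simp
    then obtain x y where x: "q = x @ D # y" "mot x" using first_descent by blast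
    have "height b (Suc (length x + Suc 0)) = 0"
      using q x by (simp only: height_Cons height_append_right) simp
    then have "\<not> Suc (length x + Suc 0) < length b"
      using pos[of "Suc (length x + Suc 0)"] by auto
    then show ?thesis using q x by auto
  qed simp
next
  assume "b = [H] \<or> (\<exists>x. mot x \<and> b = U # x @ [D])"
  then show "is_block b"
  proof
    assume "\<exists>x. mot x \<and> b = U # x @ [D]"
    then obtain x where x: "mot x" "b = U # x @ [D]" by blast
    have "0 < height b k" if k: "0 < k" "k < length b" for k
    proof -
      obtain l where l: "k = Suc l" using k by (cases k) auto
      then show ?thesis using k x mot_height_nonneg[of x l] by (simp add: height_append_left)
    qed
    moreover have "height b (length b) = 0"
      using mot_height_length[OF mot_block[OF x(1)]] x(2) by simp
    ultimately show ?thesis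
      using x(2) unfolding is_block_def by simp
  next
    assume "b = [H]"
    then show ?thesis unfolding is_block_def by blast
  qed
qed

lemma is_block_mot: "is_block b \<Longrightarrow> mot b"
  unfolding is_block_iff by (elim disjE exE conjE) (simp_all add: mot.H mot.Nil mot_block)

lemma mot_concat: "\<forall>b\<in>set bs. mot b \<Longrightarrow> mot (concat bs)"
  by (induction bs) (simp_all add: mot_append mot.Nil)

lemma mot_blocks: "mot p \<Longrightarrow> \<exists>bs. (\<forall>b\<in>set bs. is_block b) \<and> p = concat bs"
proof (induction rule: mot.induct)
  case Nil
  then show ?case by (intro exI[of _ "[]"]) simp
next
  case (H p)
  then obtain bs where "\<forall>b\<in>set bs. is_block b" "p = concat bs" by blast
  then show ?case by (intro exI[of _ "[H] # bs"]) (simp add: is_block_iff)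
next
  case (U p q)
  then obtain bs where "\<forall>b\<in>set bs. is_block b" "q = concat bs" by blast
  then show ?case using U by (intro exI[of _ "(U # p @ [D]) # bs"]) (auto simp: is_block_iff)
qed

text \<open>The grammar is unambiguous: the \<open>D\<close> that first leaves a Motzkin path
  downwards is located by the steps alone. Uniqueness of block decompositions and the analysis of
  unit segments rest on this.\<close>

lemma first_return_unique:
  "mot x \<Longrightarrow> mot x' \<Longrightarrow> x @ D # y = x' @ D # y' \<Longrightarrow> x = x' \<and> y = y'"
proof (induction arbitrary: x' y y' rule: mot.induct)
  case Nil
  from Nil(1) show ?case by (cases rule: mot.cases) (use Nil(2) in simp_all)
next
  case (H p)
  from H.prems(1) show ?case
  proof (cases rule: mot.cases)
    case (H p')
    then have "p @ D # y = p' @ D # y'" using H.prems(2) by simp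
    with H.IH[OF \<open>mot p'\<close>] H show ?thesis by blast
  qed (use H.prems(2) in simp_all)
next
  case (U p q)
  from U.prems(1) show ?case
  proof (cases rule: mot.cases)
    case (U p' q')
    then have "p @ D # (q @ D # y) = p' @ D # (q' @ D # y')" using U.prems by simp
    from U.IH(1)[OF \<open>mot p'\<close> this] have "p = p'" "q @ D # y = q' @ D # y'" by blast+
    then show ?thesis using U.IH(2)[OF \<open>mot q'\<close>] U by blast
  qed (use U.prems(2) in simp_all)
qed

subsection \<open>The multiset of parts of a path\<close>

text \<open>The value 0 on the empty multiset makes \<open>bump {#}\<close> equal to
  \<open>{#2#}\<close>, the part of the path \<open>UD\<close>.\<close>

definition max_part :: "nat multiset \<Rightarrow> nat" where
  "max_part S = (if S = {#} then 0 else Max_mset S)"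

definition bump :: "nat multiset \<Rightarrow> nat multiset" where
  "bump S = add_mset (max_part S + 2) (S - {#max_part S#})"

lemma max_part_empty [simp]: "max_part {#} = 0"
  by (simp add: max_part_def)

lemma max_part_in: "S \<noteq> {#} \<Longrightarrow> max_part S \<in># S"
  by (simp add: max_part_def)

lemma max_part_ge: "x \<in># S \<Longrightarrow> x \<le> max_part S"
  by (auto simp: max_part_def)

lemma max_part_le_iff: "max_part S \<le> k \<longleftrightarrow> (\<forall>x\<in>#S. x \<le> k)"
  by (auto simp: max_part_def)

lemma max_part_add [simp]: "max_part (S + T) = max (max_part S) (max_part T)"
proof (rule antisym)
  show "max_part (S + T) \<le> max (max_part S) (max_part T)"
    by (auto simp: max_part_le_iff intro: max_part_ge le_max_iff_disj[THEN iffD2])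
  show "max (max_part S) (max_part T) \<le> max_part (S + T)"
    by (auto simp: max_part_le_iff intro: max_part_ge)
qed

lemma max_part_add_mset [simp]: "max_part (add_mset x S) = max x (max_part S)"
  using max_part_add[of "{#x#}" S] by (simp add: max_part_def)

lemma max_part_bump [simp]: "max_part (bump S) = max_part S + 2"
proof -
  have "max_part (S - {#max_part S#}) \<le> max_part S"
    by (auto simp: max_part_le_iff intro: max_part_ge dest: in_diffD)
  then show ?thesis by (simp add: bump_def)
qed

lemma size_bump: "size (bump S) = max 1 (size S)"
proof (cases "S = {#}")
  case False
  then show ?thesis using max_part_in[OF False] by (simp add: bump_def size_Diff_singleton)
qed (simp add: bump_def)

lemma bump_nonempty [simp]: "bump S \<noteq> {#}"
  by (simp add: bump_def)

lemma sum_bump: "sum_mset (bump S) = sum_mset S + 2"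
proof (cases "S = {#}")
  case False
  then have "S = add_mset (max_part S) (S - {#max_part S#})" using max_part_in by simp
  from arg_cong[OF this, of sum_mset] show ?thesis by (simp add: bump_def)
qed (simp add: bump_def)

text \<open>On a tie it does not matter which copy of the largest part is raised, as equal members
  of a multiset are indistinguishable.\<close>

lemma bump_add: "Q \<noteq> {#} \<Longrightarrow> max_part S \<le> max_part Q \<Longrightarrow> bump (S + Q) = S + bump Q"
  using max_part_in[of Q] by (simp add: bump_def max_absorb2)

text \<open>The stack holds, for every ascent still open, the parts collected on its base line.\<close>

primrec collect :: "path \<Rightarrow> nat multiset list \<Rightarrow> nat multiset list" where
  "collect [] st = st"
| "collect (s # p) st = collect p (case s of
     U \<Rightarrow> {#} # st
   | H \<Rightarrow> add_mset 1 (hd st) # tl st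
   | D \<Rightarrow> (hd (tl st) + bump (hd st)) # tl (tl st))"

definition parts :: "path \<Rightarrow> nat multiset" where
  "parts p = hd (collect p [{#}])"

lemma collect_append [simp]: "collect (p @ q) st = collect q (collect p st)"
  by (induction p arbitrary: st) auto

text \<open>A Motzkin path never pops the stack entry on which it starts and only adds to it. Its
  whole effect is therefore captured by a run on the empty entry, which is how \<open>parts\<close>
  is defined.\<close>

lemma collect_mot_ex: "mot p \<Longrightarrow> \<exists>T. \<forall>S R. collect p (S # R) = (S + T) # R"
proof (induction rule: mot.induct)
  case Nil
  then show ?case by (intro exI[of _ "{#}"]) simp
next
  case (H p)
  then obtain T where "\<forall>S R. collect p (S # R) = (S + T) # R" by blast
  then show ?case by (intro exI[of _ "add_mset 1 T"]) simp
next
  case (U p q)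
  then obtain T T' where "\<forall>S R. collect p (S # R) = (S + T) # R" "\<forall>S R. collect q (S # R) = (S + T') # R"
    by blast
  then show ?case by (intro exI[of _ "bump T + T'"]) simp
qed

lemma collect_mot: "mot p \<Longrightarrow> collect p (S # R) = (S + parts p) # R"
  using collect_mot_ex[of p] by (auto simp: parts_def)

lemma parts_Nil [simp]: "parts [] = {#}"
  by (simp add: parts_def)

lemma parts_append [simp]: "mot p \<Longrightarrow> mot q \<Longrightarrow> parts (p @ q) = parts p + parts q"
  unfolding parts_def[of "p @ q"] by (simp add: collect_mot)

lemma parts_H [simp]: "mot p \<Longrightarrow> parts (H # p) = add_mset 1 (parts p)"
  unfolding parts_def[of "H # p"] by (simp add: collect_mot)

lemma parts_U [simp]: "mot p \<Longrightarrow> mot q \<Longrightarrow> parts (U # p @ D # q) = bump (parts p) + parts q"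
  unfolding parts_def[of "U # p @ D # q"] by (simp add: collect_mot)

lemma parts_block [simp]: "mot p \<Longrightarrow> parts (U # p @ [D]) = bump (parts p)"
  using parts_U[OF _ mot.Nil] by simp

lemma parts_concat: "\<forall>b\<in>set bs. mot b \<Longrightarrow> parts (concat bs) = (\<Sum>b\<leftarrow>bs. parts b)"
  by (induction bs) (simp_all add: mot_concat)

lemma sum_parts: "mot p \<Longrightarrow> sum_mset (parts p) = length p"
  by (induction rule: mot.induct) (simp_all add: sum_bump)

lemma parts_pos: "mot p \<Longrightarrow> x \<in># parts p \<Longrightarrow> 0 < x"
  by (induction arbitrary: x rule: mot.induct) (auto simp: bump_def dest: in_diffD)

lemma parts_eq_empty: "mot p \<Longrightarrow> parts p = {#} \<longleftrightarrow> p = []"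
  by (cases rule: mot.cases) auto

section \<open>Unit paths and paths with a single part\<close>

lemma unit_path_0 [simp]: "unit_path 0 = []"
  by (simp add: unit_path_def)

lemma unit_path_1 [simp]: "unit_path (Suc 0) = [H]"
  by (simp add: unit_path_def)

lemma unit_path_Suc_Suc: "unit_path (Suc (Suc j)) = U # unit_path j @ [D]"
  by (simp add: unit_path_def replicate_append_same)

lemma length_unit_path [simp]: "length (unit_path j) = j"
  by (simp add: unit_path_def) presburger

lemma mot_unit_path [simp]: "mot (unit_path j)"
  by (induction j rule: induct_nat_012)
     (simp_all add: mot.intros unit_path_Suc_Suc mot_block)

lemma parts_unit_path: "1 \<le> j \<Longrightarrow> parts (unit_path j) = {#j#}"
proof (induction j rule: induct_nat_012)
  case (ge2 j)
  have "parts (unit_path (Suc (Suc j))) = bump (parts (unit_path j))"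
    by (simp only: unit_path_Suc_Suc parts_block mot_unit_path)
  then show ?case
    using ge2 by (cases "j = 0") (simp_all add: bump_def max_part_def)
qed (auto simp: mot.Nil)

text \<open>Every block contributes at least one part, so a single part leaves no room for two
  blocks on the same base line: the path is a nest of blocks.\<close>

lemma unit_path_if_single:
  "mot p \<Longrightarrow> size (parts p) \<le> 1 \<Longrightarrow> p = unit_path (length p)"
proof (induction rule: mot.induct)
  case (H p)
  then show ?case by (auto simp: parts_eq_empty)
next
  case (U p q)
  then have "size (bump (parts p)) + size (parts q) \<le> 1" by simp
  moreover have "1 \<le> size (bump (parts p))" "size (parts p) \<le> size (bump (parts p))"
    by (simp_all add: size_bump)
  ultimately have "size (parts q) = 0" "size (parts p) \<le> 1" by linarith+
  then have "q = []" using U.hyps by (simp add: parts_eq_empty)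
  moreover have "p = unit_path (length p)" using U.IH(1) \<open>size (parts p) \<le> 1\<close> by blast
  ultimately show ?case using unit_path_Suc_Suc[of "length p"] by simp
qed simp

section \<open>The statistic \<open>ht\<close> as half of the largest part\<close>

lemma height_le_max: "k \<le> length p \<Longrightarrow> height p k \<le> max_height p"
  unfolding max_height_def by (rule Max_ge) auto

lemma max_height_attained: "\<exists>k\<le>length p. max_height p = height p k"
proof -
  have "max_height p \<in> height p ` {..length p}"
    unfolding max_height_def by (rule Max_in) auto
  then show ?thesis by auto
qed

text \<open>Upper bounds for \<open>ht\<close> in pointwise form, free of the maximum and of the
  case distinction; in this form they decompose along the path.\<close>

definition ht_le :: "path \<Rightarrow> rat \<Rightarrow> bool" where
  "ht_le p x \<longleftrightarrow> (\<forall>k\<le>length p. of_int (height p k) \<le> x) \<and>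
     (\<forall>k<length p. p ! k = H \<longrightarrow> of_int (height p k) + 1 / 2 \<le> x)"

lemma ht_le_iff: "ht p \<le> x \<longleftrightarrow> ht_le p x"
proof
  assume x: "ht p \<le> x"
  then have m: "of_int (max_height p) \<le> x" by (auto simp: ht_def split: if_splits)
  show "ht_le p x"
    unfolding ht_le_def
  proof (intro conjI allI impI)
    fix k assume "k \<le> length p"
    then have "(of_int (height p k) :: rat) \<le> of_int (max_height p)" by (simp add: height_le_max)
    with m show "of_int (height p k) \<le> x" by linarith
  next
    fix k assume k: "k < length p" "p ! k = H"
    show "of_int (height p k) + 1 / 2 \<le> x"
    proof (cases "height p k = max_height p")
      case True
      then have "ht p = of_int (height p k) + 1 / 2" using k unfolding ht_def by auto
      then show ?thesis using x by simp
    next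
      case False
      then have "height p k + 1 \<le> max_height p" using height_le_max[of k p] k by simp
      then have "(of_int (height p k + 1) :: rat) \<le> of_int (max_height p)" by (simp only: of_int_le_iff)
      then show ?thesis using m by simp
    qed
  qed
next
  assume x: "ht_le p x"
  obtain k where "k \<le> length p" "max_height p = height p k" using max_height_attained by blast
  then show "ht p \<le> x" using x unfolding ht_def ht_le_def by auto
qed

lemma ht_le_Cons: "ht_le (s # p) x \<longleftrightarrow>
  0 \<le> x \<and> (s = H \<longrightarrow> 1 / 2 \<le> x) \<and> ht_le p (x - of_int (rise s))"
proof -
  have "(\<forall>k\<le>Suc n. P k) \<longleftrightarrow> P 0 \<and> (\<forall>k\<le>n. P (Suc k))" for n P
    using All_less_Suc2[of "Suc n" P] by (simp only: less_Suc_eq_le)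
  moreover have "of_int (height p 0) \<le> x - (of_int (rise s) :: rat)"
    if "\<forall>k\<le>length p. of_int (height p k) \<le> x - of_int (rise s)" using that by blast
  ultimately show ?thesis
    unfolding ht_le_def length_Cons All_less_Suc2 by (simp add: le_diff_eq add.commute add.left_commute) blast
qed

lemma ht_le_Nil: "ht_le [] x \<longleftrightarrow> 0 \<le> x"
  by (simp add: ht_le_def)

lemma ht_le_nonneg: "ht_le p x \<Longrightarrow> 0 \<le> x"
  by (auto simp: ht_le_def dest: spec[of _ 0])

lemma ht_le_append: "ht_le (p @ q) x \<longleftrightarrow> ht_le p x \<and> ht_le q (x - of_int (height p (length p)))"
proof (induction p arbitrary: x)
  case Nil
  then show ?case using ht_le_nonneg by (auto simp: ht_le_Nil)
next
  case (Cons s p)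
  then show ?case by (auto simp: ht_le_Cons algebra_simps)
qed

text \<open>Both sides obey the same recursion: an \<open>H\<close> on the base line requires height
  1/2 and gives a part 1, and a surrounding \<open>U\<close>, \<open>D\<close> shifts heights by 1
  and the largest part by 2.\<close>

lemma ht_le_parts: "mot p \<Longrightarrow> ht_le p x \<longleftrightarrow> of_nat (max_part (parts p)) \<le> 2 * x"
proof (induction arbitrary: x rule: mot.induct)
  case Nil
  then show ?case by (simp add: ht_le_Nil)
next
  case (H p)
  have "ht_le (H # p) x \<longleftrightarrow> 0 \<le> x \<and> 1 \<le> 2 * x \<and> of_nat (max_part (parts p)) \<le> 2 * x"
    using H.IH[of x] by (auto simp: ht_le_Cons)
  then show ?case using H.hyps by (simp add: of_nat_max) linarith
next
  case (U p q)
  have "ht_le (U # p @ D # q) x \<longleftrightarrow>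
    0 \<le> x \<and> of_nat (max_part (parts p)) \<le> 2 * (x - 1) \<and> 0 \<le> x - 1 \<and> of_nat (max_part (parts q)) \<le> 2 * x"
    using U.hyps by (simp add: ht_le_Cons ht_le_append U.IH)
  moreover have "0 \<le> (of_nat (max_part (parts p)) :: rat)" by simp
  ultimately have "ht_le (U # p @ D # q) x \<longleftrightarrow>
    of_nat (max_part (parts p)) + 2 \<le> 2 * x \<and> of_nat (max_part (parts q)) \<le> 2 * x"
    by auto
  then show ?case using U.hyps by (simp add: of_nat_max add.commute conj_commute)
qed

lemma ht_eq_parts:
  assumes "mot p"
  shows "ht p = of_nat (max_part (parts p)) / 2"
proof (rule antisym)
  show "ht p \<le> of_nat (max_part (parts p)) / 2"
    unfolding ht_le_iff ht_le_parts[OF assms] by simp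
  have "ht_le p (ht p)" by (simp flip: ht_le_iff)
  then show "of_nat (max_part (parts p)) / 2 \<le> ht p"
    using assms by (simp add: ht_le_parts)
qed

section \<open>The multiset of parts under a step of the shape algorithm\<close>

lemma replicate_wrap: "replicate (Suc M) U @ p @ replicate (Suc M) D = U # (replicate M U @ p @ replicate M D) @ [D]"
  by (simp add: replicate_append_same)

lemma mot_wrap: "mot p \<Longrightarrow> mot (replicate M U @ p @ replicate M D)"
proof (induction M)
  case (Suc M)
  then show ?case unfolding replicate_wrap by (intro mot_block)
qed simp

lemma parts_wrap: "mot p \<Longrightarrow> parts (replicate M U @ p @ replicate M D) = (bump ^^ M) (parts p)"
proof (induction M)
  case (Suc M)
  then show ?case
    by (simp only: replicate_wrap parts_block mot_wrap funpow.simps o_apply)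
qed simp

text \<open>Each \<open>bump\<close> only increases the lead of \<open>Q\<close> over
  \<open>S\<close>, so all \<open>M\<close> of them hit \<open>Q\<close>.\<close>

lemma bump_funpow_add:
  assumes "Q \<noteq> {#}" and "max_part S \<le> max_part Q"
  shows "(bump ^^ M) (S + Q) = S + (bump ^^ M) Q \<and> (bump ^^ M) Q \<noteq> {#} \<and> max_part S \<le> max_part ((bump ^^ M) Q)"
proof (induction M)
  case (Suc M)
  then show ?case by (simp add: bump_add)
qed (use assms in simp)

lemma max_part_sum_list_le: "\<forall>q\<in>set qs. max_part (f q) \<le> k \<Longrightarrow> max_part (\<Sum>q\<leftarrow>qs. f q) \<le> k"
  by (induction qs) auto

text \<open>Maximal \<open>ht\<close> means maximal largest part. The \<open>M\<close> layers around
  the whole row of blocks therefore raise a part of \<open>qs ! t\<close>, exactly as they do when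
  moved to surround that block alone.\<close>

lemma shape_step_parts: "shape_step p p' \<Longrightarrow> mot p \<and> mot p' \<and> parts p = parts p'"
proof (induction rule: shape_step.induct)
  case (1 ps b rs M qs t)
  let ?q = "qs ! t" and ?l = "concat (take t qs)" and ?r = "concat (drop (Suc t) qs)"
  have mps: "mot (concat ps)" and mrs: "mot (concat rs)" and mq: "\<forall>q\<in>set qs. mot q"
    using 1(1,4,6) by (auto intro!: mot_concat ballI intro: is_block_mot)
  have ml: "mot ?l" and mr: "mot ?r" and mqt: "mot ?q"
    using mq 1(8) by (auto intro!: mot_concat dest: in_set_takeD in_set_dropD)
  have split: "concat qs = ?l @ ?q @ ?r"
    using arg_cong[OF id_take_nth_drop[OF 1(8)], of concat] by simp
  have mb: "mot b" using 1(2) by (rule is_block_mot)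
  have w: "mot (replicate M U @ ?q @ replicate M D)" using mqt by (rule mot_wrap)
  have "\<forall>q\<in>set qs. max_part (parts q) \<le> max_part (parts ?q)"
  proof
    fix q assume q: "q \<in> set qs"
    then have "ht q \<le> ht ?q" using 1(9) by (metis in_set_conv_nth)
    then show "max_part (parts q) \<le> max_part (parts ?q)"
      using mq q mqt by (simp add: ht_eq_parts)
  qed
  then have mxs: "max_part (\<Sum>q\<leftarrow>take t qs. parts q) \<le> max_part (parts ?q)" "max_part (\<Sum>q\<leftarrow>drop (Suc t) qs. parts q) \<le> max_part (parts ?q)"
    by (auto intro!: max_part_sum_list_le dest: in_set_takeD in_set_dropD)
  have le: "max_part (parts ?l + parts ?r) \<le> max_part (parts ?q)"
  proof -
    have "\<forall>q\<in>set (take t qs). mot q" "\<forall>q\<in>set (drop (Suc t) qs). mot q"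
      using mq set_take_subset set_drop_subset by fast+
    then show ?thesis using mxs by (simp add: parts_concat)
  qed
  have "is_block ?q" using 1(6,8) by simp
  then have "?q \<noteq> []" by (auto simp: is_block_def)
  then have ne: "parts ?q \<noteq> {#}" using mqt by (simp add: parts_eq_empty)
  have "parts b = (bump ^^ M) (parts ?l + parts ?r + parts ?q)"
  proof -
    have "mot (concat qs)" using mq by (rule mot_concat)
    then have "parts b = (bump ^^ M) (parts (concat qs))" unfolding 1(5) by (rule parts_wrap)
    also have "parts (concat qs) = parts ?l + parts ?r + parts ?q"
      unfolding split using ml mr mqt by (simp add: mot_append)
    finally show ?thesis .
  qed
  also have "\<dots> = parts ?l + parts ?r + parts (replicate M U @ ?q @ replicate M D)"
    using bump_funpow_add[OF ne le, of M] mqt by (simp add: parts_wrap)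
  also have "\<dots> = parts (?l @ (replicate M U @ ?q @ replicate M D) @ ?r)"
    unfolding parts_append[OF ml mot_append[OF w mr]] parts_append[OF w mr] by (simp add: add.commute)
  finally have eq: "parts b = parts (?l @ (replicate M U @ ?q @ replicate M D) @ ?r)" .
  have mn: "mot (?l @ (replicate M U @ ?q @ replicate M D) @ ?r)"
    by (rule mot_append[OF ml mot_append[OF w mr]])
  have "parts (concat ps @ b @ concat rs) =
    parts (concat ps @ (?l @ (replicate M U @ ?q @ replicate M D) @ ?r) @ concat rs)"
    using mps mrs mb mn eq by (simp add: mot_append del: append_assoc)
  moreover have "mot (concat ps @ b @ concat rs)" "mot (concat ps @ (?l @ (replicate M U @ ?q @ replicate M D) @ ?r) @ concat rs)"
    by (fact mot_append[OF mps mot_append[OF mb mrs]] mot_append[OF mps mot_append[OF mn mrs]])+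
  ultimately show ?case by simp
qed

subsection \<open>The shape algorithm\<close>

lemma is_block_wrap:
  assumes "is_block q"
  shows "is_block (replicate M U @ q @ replicate M D)"
proof (cases M)
  case 0
  then show ?thesis using assms by simp
next
  case (Suc N)
  have "mot (replicate N U @ q @ replicate N D)" using assms by (intro mot_wrap is_block_mot)
  then show ?thesis unfolding Suc replicate_wrap is_block_iff by blast
qed

lemma first_max_index:
  fixes f :: "nat \<Rightarrow> 'a :: linorder"
  assumes "0 < n"
  shows "\<exists>t<n. (\<forall>j<n. f j \<le> f t) \<and> (\<forall>j<t. f j < f t)"
proof -
  define P where "P t \<longleftrightarrow> t < n \<and> (\<forall>j<n. f j \<le> f t)" for t
  have fin: "finite (f ` {..<n})" "f ` {..<n} \<noteq> {}" using assms by auto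
  then have "Max (f ` {..<n}) \<in> f ` {..<n}" by (rule Max_in)
  then obtain t where "t < n" "f t = Max (f ` {..<n})" by auto
  then have "P t" using Max_ge[OF fin(1)] by (auto simp: P_def)
  then have 1: "P (LEAST t. P t)" by (rule LeastI)
  have "f j < f (LEAST t. P t)" if j: "j < (LEAST t. P t)" for j
  proof -
    have "\<not> P j" using j by (rule not_less_Least)
    with j 1 obtain i where "i < n" "f j < f i" unfolding P_def by (meson less_trans not_le)
    then show ?thesis using 1 unfolding P_def by (meson less_le_trans)
  qed
  then show ?thesis using 1 unfolding P_def by blast
qed

text \<open>A step keeps the length of the path but splits a non-unit block into at least two
  blocks, so the length minus the number of blocks decreases.\<close>

lemma shape_terminates:
  "\<forall>b\<in>set bs. is_block b \<Longrightarrow>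
   \<exists>cs. shape_step\<^sup>*\<^sup>* (concat bs) (concat cs) \<and> (\<forall>b\<in>set cs. is_block b \<and> is_unit_path b)"
proof (induction "length (concat bs) - length bs" arbitrary: bs rule: less_induct)
  case less
  show ?case
  proof (cases "\<forall>b\<in>set bs. is_unit_path b")
    case True
    then show ?thesis using less.prems by blast
  next
    case False
    then obtain ps b rs where bs: "bs = ps @ b # rs" and nb: "\<not> is_unit_path b"
      and ps: "\<forall>x\<in>set ps. is_unit_path x"
      using split_list_first_prop[of bs "\<lambda>b. \<not> is_unit_path b"] by auto
    have b: "is_block b" using bs less.prems by simp
    define P where "P M \<longleftrightarrow> (\<exists>qs. b = replicate M U @ concat qs @ replicate M D \<and> (\<forall>q\<in>set qs. is_block q))" for M
    have "P 0" unfolding P_def using b by (intro exI[of _ "[b]"]) simp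
    moreover have "\<forall>M. P M \<longrightarrow> M \<le> length b" unfolding P_def by auto
    ultimately obtain M where "P M" and M: "\<And>M'. P M' \<Longrightarrow> M' \<le> M"
      using Nat.ex_has_greatest_nat[of P 0 "length b"] by blast
    then obtain qs where qs: "b = replicate M U @ concat qs @ replicate M D" "\<forall>q\<in>set qs. is_block q"
      unfolding P_def by blast
    \<comment> \<open>No block inside gives an even unit path; a single \<open>[H]\<close> gives an
      odd one; a single block \<open>U x D\<close> would admit \<open>Suc M\<close> layers, against
      the choice of \<open>M\<close>.\<close>
    have "2 \<le> length qs"
    proof (rule ccontr)
      assume "\<not> 2 \<le> length qs"
      then consider "qs = []" | q where "qs = [q]" by (cases qs; cases "tl qs") auto
      then show False
      proof cases
        case 1
        then have "b = unit_path (2 * M)" using qs(1) by (simp add: unit_path_def)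
        moreover have "b \<noteq> []" using b by (auto simp: is_block_def)
        ultimately have "is_unit_path b" unfolding is_unit_path_def
          by (intro exI[of _ "2 * M"]) (cases M; simp)
        then show False using nb by simp
      next
        case (2 q)
        then have "is_block q" using qs(2) by simp
        then consider "q = [H]" | x where "mot x" "q = U # x @ [D]" unfolding is_block_iff by blast
        then show False
        proof cases
          case 1
          then have "b = unit_path (2 * M + 1)" using qs(1) 2 by (simp add: unit_path_def)
          then have "is_unit_path b" unfolding is_unit_path_def by (intro exI[of _ "2 * M + 1"]) auto
          then show False using nb by simp
        next
          case x: 2
          obtain qs' where qs': "\<forall>q\<in>set qs'. is_block q" "x = concat qs'" using mot_blocks x(1) by blast
          have "b = replicate (Suc M) U @ concat qs' @ replicate (Suc M) D"
            using qs(1) 2 x qs'(2) by (simp add: replicate_append_same[symmetric])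
          then have "P (Suc M)" using qs'(1) unfolding P_def by blast
          then show False using M by fastforce
        qed
      qed
    qed
    then have "0 < length qs" by linarith
    then obtain t where t: "t < length qs" "\<forall>j<length qs. ht (qs ! j) \<le> ht (qs ! t)" "\<forall>j<t. ht (qs ! j) < ht (qs ! t)"
      using first_max_index[of "length qs" "\<lambda>j. ht (qs ! j)"] by blast
    let ?w = "replicate M U @ qs ! t @ replicate M D"
    define bs' where "bs' = ps @ (take t qs @ ?w # drop (Suc t) qs) @ rs"
    have "shape_step (concat ps @ b @ concat rs)
        (concat ps @ (concat (take t qs) @ replicate M U @ qs ! t @ replicate M D @ concat (drop (Suc t) qs)) @ concat rs)"
    proof (rule shape_step.intros)
      show "M' \<le> M" if "b = replicate M' U @ concat qs' @ replicate M' D" "\<forall>q\<in>set qs'. is_block q" for M' qs'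
        using M that unfolding P_def by blast
    qed (use bs less.prems nb ps b qs t in auto)
    then have step: "shape_step (concat bs) (concat bs')" by (simp add: bs bs'_def)
    have blk: "\<forall>b\<in>set bs'. is_block b"
      using less.prems qs(2) t(1) is_block_wrap[of "qs ! t" M]
      by (auto simp: bs bs'_def dest: in_set_takeD in_set_dropD)
    have "length (concat bs') = length (concat bs)"
      using arg_cong[OF id_take_nth_drop[OF t(1)], of "\<lambda>x. length (concat x)"]
      by (simp add: bs bs'_def qs(1))
    moreover have "length bs < length bs'" using \<open>2 \<le> length qs\<close> t(1) by (simp add: bs bs'_def)
    \<comment> \<open>Blocks are nonempty, so the subtraction in the measure is not
      truncated.\<close>
    moreover have "length cs \<le> length (concat cs)" if "\<forall>b\<in>set cs. is_block b" for cs
      using that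
    proof (induction cs)
      case (Cons c cs)
      then have "c \<noteq> []" by (auto simp: is_block_def)
      then have "1 \<le> length c" by (cases c) auto
      then show ?case using Cons by simp
    qed simp
    ultimately have "length (concat bs') - length bs' < length (concat bs) - length bs"
      using blk by fastforce
    from less.hyps[OF this blk] step show ?thesis by (meson converse_rtranclp_into_rtranclp)
  qed
qed

lemma shape_steps_parts: "shape_step\<^sup>*\<^sup>* p p' \<Longrightarrow> mot p \<Longrightarrow> mot p' \<and> parts p = parts p'"
  by (induction rule: rtranclp_induct) (auto dest: shape_step_parts)

lemma parts_unit_blocks:
  "\<forall>b\<in>set bs. is_block b \<and> is_unit_path b \<Longrightarrow> parts (concat bs) = mset (map length bs)"
proof (induction bs)
  case (Cons b bs)
  then obtain j where "1 \<le> j" "b = unit_path j" by (auto simp: is_unit_path_def)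
  moreover have "mot (concat bs)" using Cons.prems by (intro mot_concat ballI is_block_mot) simp
  ultimately show ?case using Cons by (simp add: parts_unit_path)
qed simp

text \<open>Termination provides a halting decomposition, and the invariance of \<open>parts\<close>
  forces the same block lengths on every such decomposition.\<close>

lemma has_shape_iff:
  assumes "mot p"
  shows "has_shape p lam \<longleftrightarrow> lam = conjugate (rev (sorted_list_of_multiset (parts p)))"
proof -
  have *: "sort (map length bs) = sorted_list_of_multiset (parts p)"
    if "shape_step\<^sup>*\<^sup>* p (concat bs)" "\<forall>b\<in>set bs. is_block b \<and> is_unit_path b" for bs
    using shape_steps_parts[OF that(1) assms] parts_unit_blocks[OF that(2)]
    by (metis sorted_list_of_multiset_mset)
  obtain cs where "\<forall>b\<in>set cs. is_block b" "p = concat cs" using mot_blocks[OF assms] by blast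
  then obtain bs where "shape_step\<^sup>*\<^sup>* p (concat bs)" "\<forall>b\<in>set bs. is_block b \<and> is_unit_path b"
    using shape_terminates by blast
  then show ?thesis using * unfolding has_shape_def by metis
qed

subsection \<open>Conjugate partitions\<close>

lemma conjugate_eq:
  "lam \<noteq> [] \<Longrightarrow> conjugate lam = map (\<lambda>i. length (filter (\<lambda>y. i \<le> y) lam)) [1..<Suc (hd lam)]"
  by (cases lam) (simp_all add: conjugate_def del: upt_Suc)

lemma length_conjugate: "lam \<noteq> [] \<Longrightarrow> length (conjugate lam) = hd lam"
  by (simp add: conjugate_eq del: upt_Suc)

lemma nth_conjugate:
  "lam \<noteq> [] \<Longrightarrow> i < hd lam \<Longrightarrow> conjugate lam ! i = length (filter (\<lambda>y. Suc i \<le> y) lam)"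
  by (simp add: conjugate_eq del: upt_Suc)

lemma partition_hd_ge: "is_partition lam \<Longrightarrow> x \<in> set lam \<Longrightarrow> x \<le> hd lam"
  by (cases lam) (auto simp: is_partition_def)

lemma partition_conjugate:
  assumes "is_partition lam"
  shows "is_partition (conjugate lam)"
proof (cases "lam = []")
  case True
  then show ?thesis by (simp add: conjugate_def is_partition_def)
next
  case False
  have "sorted_wrt (\<ge>) (conjugate lam)"
    unfolding sorted_wrt_iff_nth_less
  proof (intro allI impI)
    fix i j assume ij: "i < j" "j < length (conjugate lam)"
    have "length (filter (\<lambda>y. Suc j \<le> y) xs) \<le> length (filter (\<lambda>y. Suc i \<le> y) xs)" for xs
      using ij(1) by (induction xs) auto
    then show "conjugate lam ! j \<le> conjugate lam ! i"
      using False ij by (simp add: nth_conjugate length_conjugate)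
  qed
  moreover have "0 < x" if "x \<in> set (conjugate lam)" for x
  proof -
    from that obtain i where "i \<in> set [1..<Suc (hd lam)]" "x = length (filter (\<lambda>y. i \<le> y) lam)"
      unfolding conjugate_eq[OF False] set_map by blast
    then have "i \<le> hd lam" "x = length (filter (\<lambda>y. i \<le> y) lam)" by (simp_all del: upt_Suc)
    moreover from this have "hd lam \<in> set (filter (\<lambda>y. i \<le> y) lam)" using False by simp
    ultimately show ?thesis by (metis length_pos_if_in_set)
  qed
  ultimately show ?thesis unfolding is_partition_def by blast
qed

text \<open>A cell lies in a Young diagram iff its mirror image lies in the transposed diagram; the
  longest rows come first, so the rows reaching column \<open>i\<close> form an initial
  segment.\<close>

lemma partition_nth_ge_iff:
  assumes "sorted_wrt (\<ge>) lam" and "j < length (lam :: nat list)"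
  shows "Suc j \<le> length (filter (\<lambda>y. i \<le> y) lam) \<longleftrightarrow> i \<le> lam ! j"
  using assms
proof (induction lam arbitrary: j)
  case (Cons x lam)
  show ?case
  proof (cases "i \<le> x")
    case True
    then show ?thesis using Cons by (cases j) auto
  next
    case False
    then have "\<forall>y\<in>set (x # lam). \<not> i \<le> y" using Cons.prems(1) by auto
    then have "filter (\<lambda>y. i \<le> y) (x # lam) = []" "\<not> i \<le> (x # lam) ! j"
      using nth_mem[OF Cons.prems(2)] by (auto simp only: filter_empty_conv)
    then show ?thesis by (simp only: list.size) simp
  qed
qed simp

lemma length_filter_upt_le: "k \<le> n \<Longrightarrow> length (filter (\<lambda>i. i \<le> k) [1..<Suc n]) = k"
proof (induction n)
  case (Suc n)
  then show ?case by (cases "k = Suc n") (simp_all add: filter_True)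
qed simp

lemma conjugate_conjugate:
  assumes "is_partition lam"
  shows "conjugate (conjugate lam) = lam"
proof (cases "lam = []")
  case True
  then show ?thesis by (simp add: conjugate_def)
next
  case False
  have pos: "\<forall>x\<in>set lam. Suc 0 \<le> x" and sorted: "sorted_wrt (\<ge>) lam"
    using assms by (auto simp: is_partition_def)
  have hd: "0 < hd lam" using pos False by (simp add: Suc_le_eq)
  have ne: "conjugate lam \<noteq> []" using length_conjugate[OF False] hd by auto
  have hdc: "hd (conjugate lam) = length lam"
    using nth_conjugate[OF False hd] pos by (simp add: hd_conv_nth[OF ne] filter_True)
  show ?thesis
  proof (rule nth_equalityI)
    show len: "length (conjugate (conjugate lam)) = length lam"
      by (simp add: length_conjugate[OF ne] hdc)
    fix j assume "j < length (conjugate (conjugate lam))"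
    then have j: "j < length lam" by (simp add: len)
    have "conjugate (conjugate lam) ! j = length (filter (\<lambda>y. Suc j \<le> y) (conjugate lam))"
      using nth_conjugate[OF ne] j hdc by simp
    also have "\<dots> = length (filter (\<lambda>i. i \<le> lam ! j) [1..<Suc (hd lam)])"
      unfolding conjugate_eq[OF False] filter_map length_map comp_def
      by (simp only: partition_nth_ge_iff[OF sorted j])
    also have "\<dots> = lam ! j"
      using partition_hd_ge[OF assms] j by (intro length_filter_upt_le) simp
    finally show "conjugate (conjugate lam) ! j = lam ! j" .
  qed
qed

text \<open>Double counting of the cells of the Young diagram.\<close>

lemma sum_list_conjugate:
  assumes "is_partition lam"
  shows "sum_list (conjugate lam) = sum_list lam"
proof (cases "lam = []")
  case False
  have "(\<Sum>i\<leftarrow>[1..<Suc n]. length (filter (\<lambda>y. i \<le> y) xs)) = sum_list xs"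
    if "\<forall>x\<in>set xs. x \<le> n" for xs n
    using that
  proof (induction xs)
    case (Cons x xs)
    have "(\<Sum>i\<leftarrow>is. length (filter (\<lambda>y. i \<le> y) (x # xs))) =
        length (filter (\<lambda>i. i \<le> x) is) + (\<Sum>i\<leftarrow>is. length (filter (\<lambda>y. i \<le> y) xs))" for "is"
      by (induction "is") auto
    then show ?case using Cons length_filter_upt_le[of x n] by (simp del: upt_Suc filter.simps)
  qed simp
  from this[of lam "hd lam"] show ?thesis
    using False partition_hd_ge[OF assms] by (simp add: conjugate_eq del: upt_Suc)
qed (simp add: conjugate_def)

lemma rev_sorted_list_partition:
  assumes "is_partition lam"
  shows "rev (sorted_list_of_multiset (mset lam)) = lam"
proof -
  have "sorted (rev lam)" using assms by (simp add: is_partition_def sorted_wrt_rev)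
  then have "sort lam = rev lam" by (intro properties_for_sort) auto
  then show ?thesis by (simp add: sorted_list_of_multiset_mset)
qed

text \<open>The positive parts, sorted downwards, form a partition, and conjugation is an involution
  on partitions. From here on shapes are replaced by multisets of parts.\<close>

lemma motzkin_of_shape_eq:
  assumes "is_partition lam"
  shows "motzkin_of_shape lam = {p. mot p \<and> parts p = mset (conjugate lam)}"
proof -
  have eq: "lam = conjugate (rev (sorted_list_of_multiset (parts p))) \<longleftrightarrow> parts p = mset (conjugate lam)"
    if p: "mot p" for p
  proof
    assume lam: "lam = conjugate (rev (sorted_list_of_multiset (parts p)))"
    have "is_partition (rev (sorted_list_of_multiset (parts p)))"
      using parts_pos[OF p] by (auto simp: is_partition_def sorted_wrt_rev)
    then have "conjugate lam = rev (sorted_list_of_multiset (parts p))"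
      unfolding lam by (rule conjugate_conjugate)
    then show "parts p = mset (conjugate lam)" by simp
  next
    assume "parts p = mset (conjugate lam)"
    then show "lam = conjugate (rev (sorted_list_of_multiset (parts p)))"
      using rev_sorted_list_partition[OF partition_conjugate[OF assms]] conjugate_conjugate[OF assms]
      by metis
  qed
  have "motzkin p \<and> has_shape p lam \<longleftrightarrow> mot p \<and> parts p = mset (conjugate lam)" for p
    unfolding motzkin_iff_mot using has_shape_iff[of p lam] eq[of p] by blast
  then show ?thesis unfolding motzkin_of_shape_def by blast
qed

text \<open>The last column counts the rows of full length \<open>hd lam\<close>. More than
  \<open>r\<close> of them means that the rows 0 to \<open>r\<close> all have this length, so
  lengthening the first \<open>r\<close> rows by \<open>m\<close> puts \<open>m\<close> new columns
  of height \<open>r\<close> at the end.\<close>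

lemma conjugate_add_columns:
  assumes "is_partition lam" and "lam \<noteq> []" and "1 \<le> r"
    and last: "r < conjugate lam ! (hd lam - 1)"
    and lam': "lam' = map (\<lambda>x. x + m) (take r lam) @ drop r lam"
  shows "is_partition lam'" and "conjugate lam' = conjugate lam @ replicate m r"
    and "\<forall>x\<in>set (conjugate lam). r < x"
    and "sum_list lam = r * hd lam + sum_list (drop r lam)"
proof -
  let ?h = "hd lam"
  have h: "0 < ?h" and sorted: "sorted_wrt (\<ge>) lam" using assms(1,2) by (auto simp: is_partition_def)
  have len: "Suc r \<le> length (filter (\<lambda>y. ?h \<le> y) lam)"
    using last h assms(2) by (simp add: nth_conjugate)
  then have rl: "r < length lam" using length_filter_le[of "\<lambda>y. ?h \<le> y" lam] by linarith
  have "lam ! j = ?h" if "j \<le> r" for j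
  proof (rule antisym)
    show "lam ! j \<le> ?h" using that rl by (intro partition_hd_ge[OF assms(1)]) simp
    show "?h \<le> lam ! j" using that rl len partition_nth_ge_iff[OF sorted, of j ?h] by simp
  qed
  then have take: "take r lam = replicate r ?h"
    using rl by (intro nth_equalityI) auto
  have lam_eq: "lam = replicate r ?h @ drop r lam" using append_take_drop_id[of r lam] take by simp
  have lam'_eq: "lam' = replicate r (?h + m) @ drop r lam" by (simp add: lam' take)
  have drop_le: "\<forall>x\<in>set (drop r lam). x \<le> ?h"
    using partition_hd_ge[OF assms(1)] by (auto dest: in_set_dropD)
  have "sorted_wrt (\<ge>) (replicate r (?h + m))" by (simp add: sorted_wrt_iff_nth_less)
  then show "is_partition lam'"
    unfolding lam'_eq is_partition_def using drop_le h sorted assms(1)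
    by (auto simp: sorted_wrt_append is_partition_def sorted_wrt_drop dest: in_set_dropD)
  have ne': "lam' \<noteq> []" "hd lam' = ?h + m" using assms(3) unfolding lam'_eq by (cases r; simp)+
  show "conjugate lam' = conjugate lam @ replicate m r"
  proof (rule nth_equalityI)
    show "length (conjugate lam') = length (conjugate lam @ replicate m r)"
      using ne' assms(2) by (simp add: length_conjugate)
    fix i assume "i < length (conjugate lam')"
    then have i: "i < ?h + m" using ne' by (simp add: length_conjugate)
    have 1: "conjugate lam' ! i = r + length (filter (\<lambda>y. Suc i \<le> y) (drop r lam))"
      using ne' i by (simp add: nth_conjugate) (simp add: lam'_eq)
    show "conjugate lam' ! i = (conjugate lam @ replicate m r) ! i"
    proof (cases "i < ?h")
      case True
      then have "conjugate lam ! i = length (filter (\<lambda>y. Suc i \<le> y) (replicate r ?h @ drop r lam))"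
        using assms(2) lam_eq by (simp add: nth_conjugate)
      then show ?thesis using 1 True assms(2) by (simp add: nth_append length_conjugate)
    next
      case False
      then have "filter (\<lambda>y. Suc i \<le> y) (drop r lam) = []" using drop_le by (auto simp: filter_empty_conv)
      then show ?thesis using 1 False i assms(2) by (simp add: nth_append length_conjugate)
    qed
  qed
  show "\<forall>x\<in>set (conjugate lam). r < x"
  proof
    fix x assume "x \<in> set (conjugate lam)"
    then obtain i where i: "i < ?h" "x = conjugate lam ! i"
      using assms(2) by (metis in_set_conv_nth length_conjugate)
    have "conjugate lam ! (?h - 1) \<le> conjugate lam ! i"
    proof (cases "i = ?h - 1")
      case False
      then show ?thesis
        using partition_conjugate[OF assms(1)] i assms(2)
        by (auto simp: is_partition_def sorted_wrt_iff_nth_less length_conjugate)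
    qed simp
    then show "r < x" using last i by simp
  qed
  show "sum_list lam = r * ?h + sum_list (drop r lam)"
    using arg_cong[OF lam_eq, of sum_list] by (simp add: sum_list_replicate)
qed

subsection \<open>Words of tokens\<close>

text \<open>Rule \<open>Y\<close> covers a base line carrying only copies of u^(r), at least one of
  which is fused with the \<open>U\<close>. The side condition of \<open>UD\<close> keeps the two
  rules apart; it also rules out empty \<open>v\<close>, so that u^(2) is never read as
  \<open>U\<close> followed by \<open>D\<close>.\<close>

inductive word :: "nat \<Rightarrow> path list \<Rightarrow> bool" for r where
  Nil: "word r []"
| Z: "word r w \<Longrightarrow> word r (unit_path r # w)"
| X: "word r w \<Longrightarrow> word r (unit_path (Suc r) # w)"
| Y: "word r w \<Longrightarrow> word r ((U # unit_path r) # replicate c (unit_path r) @ [D] # w)"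
| UD: "word r v \<Longrightarrow> word r w \<Longrightarrow> \<exists>t\<in>set v. t \<noteq> unit_path r \<Longrightarrow> word r ([U] # v @ [D] # w)"

abbreviation drop_units :: "nat \<Rightarrow> path list \<Rightarrow> path list" where
  "drop_units r \<equiv> filter (\<lambda>t. t \<noteq> unit_path r)"

lemma singleton_neq_unit [simp]: "rise s \<noteq> 0 \<Longrightarrow> [s] \<noteq> unit_path r" "rise s \<noteq> 0 \<Longrightarrow> unit_path r \<noteq> [s]"
proof -
  show 1: "unit_path r \<noteq> [s]" if "rise s \<noteq> 0"
  proof
    assume a: "unit_path r = [s]"
    from mot_height_length[OF mot_unit_path[of r]] show False unfolding a using that by simp
  qed
  then show "[s] \<noteq> unit_path r" if "rise s \<noteq> 0" using that by metis
qed

lemma unit_Suc_neq_unit [simp]: "unit_path (Suc r) \<noteq> unit_path r"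
  by (metis length_unit_path n_not_Suc_n)

lemma unit_path_eq_Nil [simp]: "unit_path r = [] \<longleftrightarrow> r = 0"
  by (metis length_unit_path list.size(3) unit_path_0)

lemma replicate_mset_plus: "replicate_mset (k + l) x = replicate_mset k x + replicate_mset l x"
  by (induction k) auto

lemma mot_replicate: "mot (concat (replicate c (unit_path r)))"
  by (intro mot_concat) simp

lemma parts_replicate: "1 \<le> r \<Longrightarrow> parts (concat (replicate c (unit_path r))) = replicate_mset c r"
  by (induction c) (simp_all add: mot_replicate parts_unit_path)

lemma concat_Y: "concat ((U # unit_path r) # replicate c (unit_path r) @ [D] # w) =
    U # (unit_path r @ concat (replicate c (unit_path r))) @ D # concat w"
  by simp

lemma mot_Y: "mot (unit_path r @ concat (replicate c (unit_path r)))"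
  by (intro mot_append mot_unit_path mot_replicate)

lemma word_mot: "word r w \<Longrightarrow> mot (concat w)"
proof (induction rule: word.induct)
  case (Y w c)
  then show ?case unfolding concat_Y by (intro mot.U mot_Y)
qed (auto intro: mot.intros mot_append)

text \<open>The copy of u^(r) fused with a \<open>U\<close> is hidden inside a longer token and
  survives the deletion, as does the witness demanded by \<open>UD\<close>.\<close>

lemma word_drop_units: "word r w \<Longrightarrow> word r (drop_units r w)"
proof (induction rule: word.induct)
  case (Y w c)
  then show ?case using word.Y[of r "drop_units r w" 0] by (simp add: filter_replicate)
next
  case (UD v w)
  then have "\<exists>t\<in>set (drop_units r v). t \<noteq> unit_path r" by auto
  with UD show ?case using word.UD[of r "drop_units r v" "drop_units r w"] by simp
qed (auto intro: word.intros)

lemma word_concat_Nil: "1 \<le> r \<Longrightarrow> word r w \<Longrightarrow> concat w = [] \<Longrightarrow> w = []"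
  by (cases rule: word.cases) auto

lemma word_Zs: "word r w \<Longrightarrow> word r (replicate k (unit_path r) @ w)"
  by (induction k) (auto intro: word.Z)

lemma drop_units_eq_Cons: "drop_units r w = t # ts \<Longrightarrow> \<exists>k w'. w = replicate k (unit_path r) @ t # w' \<and> drop_units r w' = ts"
  unfolding filter_eq_Cons_iff by (metis replicate_length_same)

lemma drop_units_eq_append: "drop_units r w = a @ b \<Longrightarrow> \<exists>w1 w2. w = w1 @ w2 \<and> drop_units r w1 = a \<and> drop_units r w2 = b"
proof (induction a arbitrary: w)
  case Nil
  then have "w = [] @ w \<and> drop_units r [] = [] \<and> drop_units r w = b" by simp
  then show ?case by blast
next
  case (Cons t a)
  then obtain k w' where w': "w = replicate k (unit_path r) @ t # w'" "drop_units r w' = a @ b"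
    using drop_units_eq_Cons by fastforce
  with Cons.IH obtain w1 w2 where "w' = w1 @ w2" "drop_units r w1 = a" "drop_units r w2 = b" by blast
  moreover have "t \<in> set (drop_units r w)" unfolding Cons.prems by simp
  then have "t \<noteq> unit_path r" by simp
  ultimately have "w = (replicate k (unit_path r) @ t # w1) @ w2 \<and>
      drop_units r (replicate k (unit_path r) @ t # w1) = t # a \<and> drop_units r w2 = b"
    using w'(1) by (simp add: filter_replicate)
  then show ?case by blast
qed

section \<open>Parts and number of tokens of a word\<close>

lemma parts_UD_nonempty:
  assumes "1 \<le> r" "word r v" "\<exists>t\<in>set v. t \<noteq> unit_path r"
  shows "parts (concat v) \<noteq> {#}" "parts (concat (drop_units r v)) \<noteq> {#}"
proof -
  have "v \<noteq> []" "drop_units r v \<noteq> []" using assms(3) by (auto simp: filter_empty_conv)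
  then have "concat v \<noteq> []" "concat (drop_units r v) \<noteq> []"
    using word_concat_Nil assms(1,2) word_drop_units by blast+
  then show "parts (concat v) \<noteq> {#}" "parts (concat (drop_units r v)) \<noteq> {#}"
    using parts_eq_empty word_mot word_drop_units assms(2) by blast+
qed

text \<open>The tokens other than u^(r) create parts r + 1 and r + 2. The word inside a
  \<open>UD\<close> block has such a part, so \<open>bump\<close> raises a large part and never
  creates a new part 2.\<close>

lemma parts_drop_units_gt: "1 \<le> r \<Longrightarrow> word r w \<Longrightarrow> x \<in># parts (concat (drop_units r w)) \<Longrightarrow> r < x"
proof (rotate_tac, induction arbitrary: x rule: word.induct)
  case (X w)
  then show ?case using word_mot[OF word_drop_units[of r w]] by (auto simp: parts_unit_path)
next
  case (Y w c)
  then show ?case using word_mot[OF word_drop_units[of r w]]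
    by (auto simp: filter_replicate parts_unit_path bump_def)
next
  case (UD v w)
  have m: "mot (concat (drop_units r v))" "mot (concat (drop_units r w))" using UD.hyps word_drop_units word_mot by blast+
  have ne: "parts (concat (drop_units r v)) \<noteq> {#}" using parts_UD_nonempty UD.hyps UD.prems by blast
  have "r < max_part (parts (concat (drop_units r v)))" using UD.IH(1) max_part_in[OF ne] UD.prems by blast
  then show ?case using UD.prems UD.IH m by (auto simp: bump_def dest: in_diffD)
qed auto

text \<open>No token u^(r) ever supplies the part that is raised. In a \<open>Y\<close> block the
  raised copy is the one fused with \<open>U\<close>, and in a \<open>UD\<close> block some part
  above \<open>r\<close> takes the bump; so the tokens u^(r) just contribute their own
  length.\<close>

lemma parts_word:
  "1 \<le> r \<Longrightarrow> word r w \<Longrightarrow>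
    parts (concat w) = parts (concat (drop_units r w)) + replicate_mset (count_list w (unit_path r)) r"
proof (rotate_tac, induction rule: word.induct)
  case (Z w)
  then show ?case using word_mot[OF word_drop_units[of r w]] word_mot[of r w] by (auto simp: parts_unit_path)
next
  case (X w)
  then show ?case using word_mot[OF word_drop_units[of r w]] word_mot[of r w] by (auto simp: parts_unit_path)
next
  case (Y w c)
  have m: "mot (concat w)" "mot (concat (drop_units r w))" using Y.hyps word_drop_units word_mot by blast+
  have "parts (unit_path r @ concat (replicate c (unit_path r))) = replicate_mset c r + {#r#}"
    using Y.prems by (simp add: parts_unit_path parts_replicate mot_replicate)
  moreover have "bump (replicate_mset c r + {#r#}) = replicate_mset c r + bump {#r#}"
    by (intro bump_add) (auto simp: max_part_le_iff)
  ultimately have "parts (concat ((U # unit_path r) # replicate c (unit_path r) @ [D] # w)) =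
    replicate_mset c r + bump {#r#} + parts (concat w)"
    unfolding concat_Y parts_U[OF mot_Y m(1)] by (simp only:)
  moreover have "count_list (replicate c (unit_path r)) (unit_path r) = c"
    by (induction c) auto
  ultimately show ?case using Y m
    by (simp add: filter_replicate parts_unit_path replicate_mset_plus count_list_append)
next
  case (UD v w)
  have m: "mot (concat w)" "mot (concat (drop_units r w))" "mot (concat v)" "mot (concat (drop_units r v))"
    using UD.hyps word_drop_units word_mot by blast+
  have ne: "parts (concat (drop_units r v)) \<noteq> {#}" using parts_UD_nonempty UD.hyps UD.prems by blast
  then have "r \<le> max_part (parts (concat (drop_units r v)))"
    using parts_drop_units_gt[OF UD.prems UD.hyps(1)] max_part_in by (meson less_imp_le)
  then have "bump (replicate_mset k r + parts (concat (drop_units r v))) =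
      replicate_mset k r + bump (parts (concat (drop_units r v)))" for k
    using ne by (intro bump_add) (auto simp: max_part_le_iff)
  then show ?case using UD m
    by (simp add: count_list_append replicate_mset_plus add.commute add.left_commute)
qed simp

lemma length_drop_units_count: "length (drop_units r w) + count_list w (unit_path r) = length w"
  by (induction w) auto

text \<open>A token u^(r+1) has r + 1 steps and yields one part; the two tokens of a
  \<open>Y\<close> block have r + 2 steps and yield one part; a pair \<open>U\<close>,
  \<open>D\<close> has two steps and leaves the number of parts unchanged. So each part accounts for
  \<open>r\<close> steps beyond the token count.\<close>

lemma length_word:
  "1 \<le> r \<Longrightarrow> word r w \<Longrightarrow> unit_path r \<notin> set w \<Longrightarrow>
    length w + r * size (parts (concat w)) = length (concat w)"
proof (rotate_tac, induction rule: word.induct)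
  case (X w)
  then show ?case using word_mot[of r w] by (auto simp: parts_unit_path)
next
  case (Y w c)
  then have "c = 0" by auto
  then show ?case using word_mot[of r w] Y by (auto simp: parts_unit_path size_bump)
next
  case (UD v w)
  have "mot (concat v)" "mot (concat w)" using UD.hyps word_mot by blast+
  moreover have "parts (concat v) \<noteq> {#}" using parts_UD_nonempty UD.hyps UD.prems by blast
  then have "max 1 (size (parts (concat v))) = size (parts (concat v))"
    by (metis Suc_leI max.absorb2 nonempty_has_size One_nat_def)
  ultimately show ?case using UD by (simp add: size_bump algebra_simps)
qed simp_all

text \<open>Converse of \<open>word_drop_units\<close>: tokens u^(r) may enter at any gap. Copies
  right after a fused token are absorbed by the exponent \<open>c\<close> of rule \<open>Y\<close>,
  and copies before the closing \<open>D\<close> of a \<open>UD\<close> block by its inner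
  word.\<close>

lemma word_of_drop_units: "word r ts \<Longrightarrow> drop_units r w = ts \<Longrightarrow> word r w"
proof (induction arbitrary: w rule: word.induct)
  case Nil
  then have "\<forall>t\<in>set w. t = unit_path r" by (simp add: filter_empty_conv)
  then have "replicate (length w) (unit_path r) = w" by (rule replicate_length_same)
  then show ?case using word_Zs[OF word.Nil, of r "length w"] by simp
next
  case (Z v)
  then have "unit_path r \<in> set (drop_units r w)" by simp
  then show ?case by simp
next
  case (X v)
  then obtain k w' where "w = replicate k (unit_path r) @ unit_path (Suc r) # w'" "drop_units r w' = v"
    using drop_units_eq_Cons by blast
  then show ?case using X.IH by (auto intro: word_Zs word.X)
next
  case (Y v c)
  have "unit_path r \<notin> set (drop_units r w)" by simp
  \<comment> \<open>The reduced word contains no u^(r), so only the fused copy remains.\<close>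
  with Y.prems have "c = 0" by auto
  with Y.prems obtain k w' where w': "w = replicate k (unit_path r) @ (U # unit_path r) # w'" "drop_units r w' = [D] # v"
    using drop_units_eq_Cons[of r w "U # unit_path r" "[D] # v"] by auto
  then obtain l w'' where "w' = replicate l (unit_path r) @ [D] # w''" "drop_units r w'' = v"
    using drop_units_eq_Cons by blast
  then show ?case using Y.IH w' by (auto intro: word_Zs word.Y)
next
  case (UD v v')
  then obtain k w' where w': "w = replicate k (unit_path r) @ [U] # w'" "drop_units r w' = v @ [D] # v'"
    using drop_units_eq_Cons by blast
  then obtain w1 w2 where w12: "w' = w1 @ w2" "drop_units r w1 = v" "drop_units r w2 = [D] # v'"
    using drop_units_eq_append by blast
  then obtain l w3 where w3: "w2 = replicate l (unit_path r) @ [D] # w3" "drop_units r w3 = v'"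
    using drop_units_eq_Cons by blast
  have "drop_units r (w1 @ replicate l (unit_path r)) = v" using w12 by (simp add: filter_replicate)
  then have "word r (w1 @ replicate l (unit_path r))" "word r w3"
    using UD.IH w3 by blast+
  moreover have "\<exists>t\<in>set (w1 @ replicate l (unit_path r)). t \<noteq> unit_path r"
    using UD.hyps(3) w12(2) by auto
  ultimately have "word r ([U] # (w1 @ replicate l (unit_path r)) @ [D] # w3)" by (rule word.UD)
  then show ?case using w' w12 w3 word_Zs by simp
qed

section \<open>Uniqueness and existence of the factorisation into tokens\<close>

lemma block_append_unique:
  assumes "is_block a" "is_block a'" "a @ b = a' @ b'"
  shows "a = a' \<and> b = b'"
proof -
  consider "a = [H]" "a' = [H]" | x x' where "mot x" "mot x'" "a = U # x @ [D]" "a' = U # x' @ [D]"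
    using assms unfolding is_block_iff by (elim disjE exE conjE) auto
  then show ?thesis
  proof cases
    case 2
    then show ?thesis using first_return_unique[of x x' b b'] assms(3) by simp
  qed (use assms(3) in simp)
qed

lemma is_block_unit_path: "1 \<le> j \<Longrightarrow> is_block (unit_path j)"
  using mot_unit_path unit_path_Suc_Suc
  by (cases j; cases "j - 1") (auto simp: is_block_iff)

text \<open>The four rules that start a nonempty word are told apart by the largest part of the
  first block: r, r + 1, r + 2, or more. This number is visible in the path, whereas the tokens are
  not.\<close>

lemma word_first_block:
  assumes "1 \<le> r" "word r w" "w \<noteq> []"
  shows "\<exists>h w0. w = h @ w0 \<and> h \<noteq> [] \<and> word r w0 \<and> is_block (concat h) \<and>
    (h = [unit_path r] \<and> max_part (parts (concat h)) = r \<or>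
     h = [unit_path (Suc r)] \<and> max_part (parts (concat h)) = r + 1 \<or>
     (\<exists>c. h = (U # unit_path r) # replicate c (unit_path r) @ [[D]]) \<and> max_part (parts (concat h)) = r + 2 \<or>
     (\<exists>v. h = [U] # v @ [[D]] \<and> word r v) \<and> r + 2 < max_part (parts (concat h)))"
  using assms(2)
proof (cases rule: word.cases)
  case Nil
  then show ?thesis using assms(3) by simp
next
  case (Z v)
  then show ?thesis using assms(1)
    by (intro exI[of _ "[unit_path r]"] exI[of _ v]) (simp add: parts_unit_path is_block_unit_path)
next
  case (X v)
  then show ?thesis
    by (intro exI[of _ "[unit_path (Suc r)]"] exI[of _ v]) (simp add: parts_unit_path is_block_unit_path)
next
  case (Y v c)
  let ?h = "(U # unit_path r) # replicate c (unit_path r) @ [[D]]"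
  have h: "concat ?h = U # (unit_path r @ concat (replicate c (unit_path r))) @ [D]" by simp
  have "max_part (parts (unit_path r @ concat (replicate c (unit_path r)))) = r"
    using assms(1) by (simp add: mot_replicate parts_unit_path parts_replicate)
       (auto simp: max_part_le_iff intro!: max_absorb1)
  then have "max_part (parts (concat ?h)) = r + 2" unfolding h parts_block[OF mot_Y] by simp
  moreover have "is_block (concat ?h)" unfolding h is_block_iff using mot_Y by blast
  moreover have "w = ?h @ v" using Y by simp
  ultimately show ?thesis using Y(2) by blast
next
  case (UD v v')
  let ?h = "[U] # v @ [[D]]"
  have h: "concat ?h = U # concat v @ [D]" by simp
  have m: "mot (concat v)" using word_mot UD by blast
  have "parts (concat (drop_units r v)) \<noteq> {#}" using parts_UD_nonempty UD assms(1) by blast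
  from max_part_in[OF this] have "r < max_part (parts (concat (drop_units r v)))"
    using parts_drop_units_gt[OF assms(1)] UD by blast
  then have "r < max_part (parts (concat v))" using parts_word[OF assms(1)] UD by simp
  then have "r + 2 < max_part (parts (concat ?h))" unfolding h parts_block[OF m] by simp
  moreover have "is_block (concat ?h)" unfolding h is_block_iff using m by blast
  moreover have "w = ?h @ v'" using UD by simp
  ultimately show ?thesis using UD by blast
qed

text \<open>The path determines its first block, whose largest part determines the rule; the inner
  word and the remaining word are shorter.\<close>

lemma word_unique:
  "1 \<le> r \<Longrightarrow> word r w \<Longrightarrow> word r w' \<Longrightarrow> concat w = concat w' \<Longrightarrow> w = w'"
proof (induction "length w" arbitrary: w w' rule: less_induct)
  case less
  note r = less.prems(1)
  show ?case
  proof (cases "w = [] \<or> w' = []")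
    case True
    then show ?thesis using word_concat_Nil[OF r] less.prems by (metis concat.simps(1))
  next
    case False
    define K where "K h \<longleftrightarrow> (h = [unit_path r] \<and> max_part (parts (concat h)) = r \<or>
     h = [unit_path (Suc r)] \<and> max_part (parts (concat h)) = r + 1 \<or>
     (\<exists>c. h = (U # unit_path r) # replicate c (unit_path r) @ [[D]]) \<and> max_part (parts (concat h)) = r + 2 \<or>
     (\<exists>v. h = [U] # v @ [[D]] \<and> word r v) \<and> r + 2 < max_part (parts (concat h)))" for h
    obtain h w0 where h: "w = h @ w0" "h \<noteq> []" "word r w0" "is_block (concat h)" "K h"
      using word_first_block[OF r less.prems(2)] False unfolding K_def by blast
    obtain h' w0' where h': "w' = h' @ w0'" "h' \<noteq> []" "word r w0'" "is_block (concat h')" "K h'"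
      using word_first_block[OF r less.prems(3)] False unfolding K_def by blast
    have "concat h @ concat w0 = concat h' @ concat w0'" using less.prems(4) h(1) h'(1) by simp
    then have eq: "concat h = concat h'" "concat w0 = concat w0'"
      using block_append_unique[OF h(4) h'(4)] by blast+
    have "w0 = w0'" using less.hyps[of w0 w0'] eq(2) h h' r by simp
    moreover have "h = h'"
    proof -
      let ?m = "max_part (parts (concat h))"
      consider "?m = r" | "?m = r + 1" | "?m = r + 2" | "r + 2 < ?m" using h(5) unfolding K_def by blast
      then show ?thesis
      proof cases
        case 1
        then show ?thesis using h(5) h'(5) unfolding K_def eq(1)[symmetric] by simp
      next
        case 2
        then show ?thesis using h(5) h'(5) unfolding K_def eq(1)[symmetric] by simp
      next
        case 3
        then obtain c c' where c: "h = (U # unit_path r) # replicate c (unit_path r) @ [[D]]"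
          "h' = (U # unit_path r) # replicate c' (unit_path r) @ [[D]]"
          using h(5) h'(5) unfolding K_def eq(1)[symmetric] by auto
        \<comment> \<open>The exponent is recovered from the length of the block, as
          \<open>r\<close> is positive.\<close>
        have "length (concat (replicate n (unit_path r))) = n * r" for n by (induction n) auto
        with arg_cong[OF eq(1), of length] c r show ?thesis by simp
      next
        case 4
        then obtain v v' where v: "h = [U] # v @ [[D]]" "word r v" "h' = [U] # v' @ [[D]]" "word r v'"
          using h(5) h'(5) unfolding K_def eq(1)[symmetric] by auto
        then have "v = v'" using less.hyps[of v v'] h(1) r eq(1) by simp
        then show ?thesis using v by simp
      qed
    qed
    ultimately show ?thesis using h(1) h'(1) by simp
  qed
qed

text \<open>\<open>bump\<close> changes only the largest inner part, so the others are at least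
  \<open>r\<close>. If the largest is too, induction applies inside the block. Otherwise there can
  be no others, the inside is a unit path, and since its length plus 2 is at least \<open>r\<close>
  the block is u^(r) or u^(r+1).\<close>

lemma word_exists:
  "1 \<le> r \<Longrightarrow> mot p \<Longrightarrow> \<forall>x\<in>#parts p. r \<le> x \<Longrightarrow> \<exists>w. word r w \<and> concat w = p"
proof (rotate_tac, induction rule: mot.induct)
  case Nil
  then show ?case using word.Nil by fastforce
next
  case (H p)
  then have "r = 1" by simp
  with H obtain w where "word r w" "concat w = p" by auto
  then show ?case using word.Z[of r w] \<open>r = 1\<close> by fastforce
next
  case (U p q)
  have bp: "\<forall>x\<in>#bump (parts p). r \<le> x" and "\<forall>x\<in>#parts q. r \<le> x"
    using U by auto
  with U obtain w where w: "word r w" "concat w = q" by blast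
  show ?case
  proof (cases "r \<le> max_part (parts p)")
    case True
    have "r \<le> x" if "x \<in># parts p" for x
      using True bp that by (cases "x = max_part (parts p)") (auto simp: bump_def in_diff_count)
    with U obtain v where v: "word r v" "concat v = p" by blast
    show ?thesis
    proof (cases "\<exists>t\<in>set v. t \<noteq> unit_path r")
      case True
      then show ?thesis using word.UD[OF v(1) w(1)] v w by fastforce
    next
      case False
      then have v': "v = replicate (length v) (unit_path r)" by (metis replicate_length_same)
      have "v \<noteq> []" using v(2) True U.prems by auto
      then obtain c where "length v = Suc c" by (cases v) auto
      with v' have "v = unit_path r # replicate c (unit_path r)" by simp
      then show ?thesis using word.Y[OF w(1), of c] v(2) w(2) by fastforce
    qed
  next
    case False
    have "parts p - {#max_part (parts p)#} = {#}"
    proof (rule ccontr)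
      assume "parts p - {#max_part (parts p)#} \<noteq> {#}"
      then obtain x where x: "x \<in># parts p - {#max_part (parts p)#}" by blast
      then have "r \<le> x" using bp by (auto simp: bump_def)
      moreover have "x \<le> max_part (parts p)" using x by (blast intro: max_part_ge dest: in_diffD)
      ultimately show False using False by simp
    qed
    then have "size (parts p) \<le> 1"
      using max_part_in[of "parts p"] by (cases "parts p = {#}") (auto dest: size_Diff_singleton[of _ "parts p"])
    then have p: "p = unit_path (length p)" using unit_path_if_single U.hyps by blast
    then have up: "U # p @ D # q = unit_path (Suc (Suc (length p))) @ concat w"
      unfolding unit_path_Suc_Suc w(2) by simp
    have "max_part (parts p) = length p"
    proof (cases "length p = 0")
      case False
      then have "parts (unit_path (length p)) = {#length p#}" using False by (intro parts_unit_path) linarith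
      then have "parts p = {#length p#}" using p by metis
      then show ?thesis by simp
    qed simp
    moreover have "r \<le> max_part (parts p) + 2" using bp by (auto simp: bump_def)
    ultimately have "Suc (Suc (length p)) = r \<or> Suc (Suc (length p)) = Suc r" using False by auto
    then show ?thesis
      unfolding up using word.Z[OF w(1)] word.X[OF w(1)] by (metis concat.simps(2))
  qed
qed

subsection \<open>Insertion of unit paths\<close>

text \<open>Counting tokens from the right makes the label of the point in front of a suffix \<open>ts\<close>
  equal to \<open>length ts\<close>.\<close>

primrec insert_units :: "nat \<Rightarrow> nat multiset \<Rightarrow> path list \<Rightarrow> path list" where
  "insert_units r A [] = replicate (count A 0) (unit_path r)"
| "insert_units r A (t # ts) = replicate (count A (Suc (length ts))) (unit_path r) @ t # insert_units r A ts"

text \<open>Positions carrying the labels after the insertions recorded in \<open>A\<close>, listed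
  from left to right: in each gap the label sits to the right of the copies inserted there. For
  empty \<open>A\<close> these are the token boundaries.\<close>

primrec free_points :: "nat \<Rightarrow> nat multiset \<Rightarrow> path list \<Rightarrow> nat list" where
  "free_points r A [] = [count A 0 * r]"
| "free_points r A (t # ts) = count A (Suc (length ts)) * r #
     map ((+) (count A (Suc (length ts)) * r + length t)) (free_points r A ts)"

lemma length_free_points [simp]: "length (free_points r A ts) = Suc (length ts)"
  by (induction ts) auto

lemma insert_units_free_points_add_mset_out:
  "length ts < a \<Longrightarrow> insert_units r (add_mset a A) ts = insert_units r A ts \<and> free_points r (add_mset a A) ts = free_points r A ts"
  by (induction ts) auto

lemma length_concat_replicate [simp]: "length (concat (replicate n x)) = n * length x"
  by (induction n) auto

lemma concat_replicate_comm: "concat (replicate n x) @ x = x @ concat (replicate n x)"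
  by (induction n) auto

text \<open>Copies in the same gap are equal, so inserting after them amounts to raising the
  multiplicity of the label; hence the state of the iteration depends only on the multiset of labels
  used so far.\<close>

lemma insert_unit_insert_units:
  assumes "a \<le> length ts" and "\<forall>t\<in>set ts. t \<noteq> []"
  shows "insert_unit r a (concat (insert_units r A ts), rev (free_points r A ts)) =
    (concat (insert_units r (add_mset a A) ts), rev (free_points r (add_mset a A) ts))"
proof -
  have "(let k = rev (free_points r A ts) ! a; p = concat (insert_units r A ts) in
      take k p @ unit_path r @ drop k p = concat (insert_units r (add_mset a A) ts) \<and>
      map (\<lambda>l. if l < k then l else l + r) (free_points r A ts) = free_points r (add_mset a A) ts)"
    using assms
  proof (induction ts)
    case Nil
    then show ?case by (simp add: concat_replicate_comm)
  next
    case (Cons t ts)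
    let ?c = "count A (Suc (length ts))"
    show ?case
    proof (cases "a = Suc (length ts)")
      case True
      then have "rev (free_points r A (t # ts)) ! a = ?c * r" by (simp add: nth_append)
      then show ?thesis
        using True insert_units_free_points_add_mset_out[of ts a r A]
        by (simp add: concat_replicate_comm[symmetric] add.commute add.left_commute)
    next
      case False
      define k where "k = rev (free_points r A ts) ! a"
      define o' where "o' = ?c * r + length t"
      have a: "a \<le> length ts" using False Cons.prems by simp
      then have k: "rev (free_points r A (t # ts)) ! a = o' + k"
        by (simp add: nth_append k_def o'_def rev_map)
      have IH: "take k (concat (insert_units r A ts)) @ unit_path r @ drop k (concat (insert_units r A ts)) =
          concat (insert_units r (add_mset a A) ts)"
        "map (\<lambda>l. if l < k then l else l + r) (free_points r A ts) = free_points r (add_mset a A) ts"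
        using Cons a by (simp_all add: Let_def k_def)
      have "concat (insert_units r A (t # ts)) = (concat (replicate ?c (unit_path r)) @ t) @ concat (insert_units r A ts)"
        by simp
      moreover have "length (concat (replicate ?c (unit_path r)) @ t) = o'" by (simp add: o'_def)
      ultimately have "take (o' + k) (concat (insert_units r A (t # ts))) @ unit_path r @ drop (o' + k) (concat (insert_units r A (t # ts))) =
         (concat (replicate ?c (unit_path r)) @ t) @ concat (insert_units r (add_mset a A) ts)"
        unfolding IH(1)[symmetric] by (simp only: take_append drop_append) simp
      also have "\<dots> = concat (insert_units r (add_mset a A) (t # ts))" using False by simp
      finally have 1: "take (o' + k) (concat (insert_units r A (t # ts))) @ unit_path r @ drop (o' + k) (concat (insert_units r A (t # ts))) =
         concat (insert_units r (add_mset a A) (t # ts))" .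
      \<comment> \<open>Strict because \<open>t\<close> is nonempty: the points left of the chosen
        gap must not be shifted.\<close>
      have "?c * r < o' + k" using Cons.prems by (simp add: o'_def)
      moreover have "map (\<lambda>l. if l < o' + k then l else l + r) (map ((+) o') (free_points r A ts)) =
          map ((+) o') (map (\<lambda>l. if l < k then l else l + r) (free_points r A ts))"
        by simp
      ultimately have "map (\<lambda>l. if l < o' + k then l else l + r) (free_points r A (t # ts)) = free_points r (add_mset a A) (t # ts)"
        using False IH(2) by (simp add: o'_def del: map_map)
      with 1 show ?thesis unfolding k Let_def by blast
    qed
  qed
  then show ?thesis by (simp add: insert_unit_def Let_def flip: rev_map)
qed

lemma fold_insert_unit:
  assumes "\<forall>t\<in>set ts. t \<noteq> []"
  shows "\<forall>a\<in>set as. a \<le> length ts \<Longrightarrow>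
    fold (insert_unit r) as (concat (insert_units r A ts), rev (free_points r A ts)) =
      (concat (insert_units r (mset as + A) ts), rev (free_points r (mset as + A) ts))"
  by (induction as arbitrary: A) (use assms in \<open>simp_all add: insert_unit_insert_units\<close>)

lemma insert_units_empty: "insert_units r {#} ts = ts"
  by (induction ts) auto

lemma psi_eq:
  assumes "\<forall>t\<in>set ts. t \<noteq> []" and "labeled_points r (concat ts) = rev (free_points r {#} ts)"
    and "\<forall>a\<in>set as. a \<le> length ts"
  shows "psi r (as, concat ts) = concat (insert_units r (mset as) ts)"
  using fold_insert_unit[OF assms(1,3), of r "{#}"] assms(2) by (simp add: psi_def insert_units_empty)

lemma drop_units_insert_units: "unit_path r \<notin> set ts \<Longrightarrow> drop_units r (insert_units r A ts) = ts"
  by (induction ts) (auto simp: filter_replicate)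

lemma count_list_insert_units:
  assumes "unit_path r \<notin> set ts" "set_mset A \<subseteq> {..length ts}"
  shows "count_list (insert_units r A ts) (unit_path r) = size A"
proof -
  have len: "length (insert_units r (add_mset a B) ts) = Suc (length (insert_units r B ts))" if "a \<le> length ts" for a B ts
    using that
  proof (induction ts)
    case (Cons t ts)
    then show ?case by (cases "a = Suc (length ts)") (simp_all add: insert_units_free_points_add_mset_out)
  qed simp
  have "length (insert_units r A ts) = length ts + size A"
    using assms(2) by (induction A) (simp_all add: insert_units_empty len)
  then show ?thesis
    using length_drop_units_count[of r "insert_units r A ts"] drop_units_insert_units[OF assms(1), of A] by simp
qed

lemma replicate_Cons_unique:
  "replicate k z @ t # xs = replicate l z @ t' # ys \<Longrightarrow> t \<noteq> z \<Longrightarrow> t' \<noteq> z \<Longrightarrow> k = l \<and> xs = ys"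
proof (induction k arbitrary: l)
  case 0
  then show ?case by (cases l) auto
next
  case (Suc k)
  then show ?case by (cases l) auto
qed

lemma insert_units_inj:
  "unit_path r \<notin> set ts \<Longrightarrow> insert_units r A ts = insert_units r B ts \<Longrightarrow> a \<le> length ts \<Longrightarrow> count A a = count B a"
proof (induction ts)
  case Nil
  then show ?case by (metis insert_units.simps(1) length_replicate le_zero_eq list.size(3))
next
  case (Cons t ts)
  then have "count A (Suc (length ts)) = count B (Suc (length ts))" "insert_units r A ts = insert_units r B ts"
    using replicate_Cons_unique[of "count A (Suc (length ts))" "unit_path r" t "insert_units r A ts"
        "count B (Suc (length ts))" t "insert_units r B ts"] by auto
  then show ?case using Cons by (cases "a = Suc (length ts)") auto
qed

lemma insert_units_surj: "\<exists>A. set_mset A \<subseteq> {..length (drop_units r w)} \<and> w = insert_units r A (drop_units r w)"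
proof (induction w)
  case Nil
  show ?case by (intro exI[of _ "{#}"]) simp
next
  case (Cons t w)
  then obtain A where A: "set_mset A \<subseteq> {..length (drop_units r w)}" "w = insert_units r A (drop_units r w)" by blast
  show ?case
  proof (cases "t = unit_path r")
    case True
    have "insert_units r (add_mset (length ts) A) ts = unit_path r # insert_units r A ts" for ts
      by (cases ts) (simp_all add: insert_units_free_points_add_mset_out)
    then have "t # w = insert_units r (add_mset (length (drop_units r w)) A) (drop_units r (t # w))"
      using A(2) True by simp
    moreover have "set_mset (add_mset (length (drop_units r w)) A) \<subseteq> {..length (drop_units r (t # w))}"
      using A(1) True by simp
    ultimately show ?thesis by blast
  next
    case False
    \<comment> \<open>The gap in front of \<open>t\<close> has a label beyond those in
      \<open>A\<close>, so nothing is inserted there.\<close>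
    have "Suc (length (drop_units r w)) \<notin># A" using A(1) by auto
    then have "count A (Suc (length (drop_units r w))) = 0" by (simp add: count_eq_zero_iff)
    then have "t # w = insert_units r A (drop_units r (t # w))" using A(2) False by simp
    moreover have "set_mset A \<subseteq> {..length (drop_units r (t # w))}" using A(1) False by auto
    ultimately show ?thesis by blast
  qed
qed

subsection \<open>Marked points\<close>

lemma unit_segment_iff:
  "unit_segment p i j \<longleftrightarrow> 1 \<le> j \<and> (\<exists>a b. p = a @ unit_path j @ b \<and> length a = i)"
proof
  assume *: "unit_segment p i j"
  have "p = take i p @ take j (drop i p) @ drop j (drop i p)" by (simp only: append_take_drop_id)
  with * show "1 \<le> j \<and> (\<exists>a b. p = a @ unit_path j @ b \<and> length a = i)"
    unfolding unit_segment_def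
    by (intro conjI exI[of _ "take i p"] exI[of _ "drop j (drop i p)"]) auto
next
  assume "1 \<le> j \<and> (\<exists>a b. p = a @ unit_path j @ b \<and> length a = i)"
  then show "unit_segment p i j" by (auto simp: unit_segment_def)
qed

lemma unit_segment_shift:
  "unit_segment x i j \<Longrightarrow> unit_segment (a @ x @ b) (length a + i) j"
  unfolding unit_segment_iff by (metis append_assoc length_append)

text \<open>A unit segment that is not the whole first block lies inside it or behind it: running
  past the closing \<open>D\<close> from within would take it below its own base line.\<close>

lemma unit_segment_split:
  assumes x: "mot x"
  shows "unit_segment (U # x @ D # y) i j \<longleftrightarrow>
    i = 0 \<and> j = length x + 2 \<and> x = unit_path (length x) \<or>
    (\<exists>i'. i = Suc i' \<and> unit_segment x i' j) \<or>
    (\<exists>i'. i = length x + 2 + i' \<and> unit_segment y i' j)" (is "?L \<longleftrightarrow> ?R")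
proof
  assume ?L
  then obtain a b where j: "1 \<le> j" and p: "U # x @ D # y = a @ unit_path j @ b" and a: "length a = i"
    unfolding unit_segment_iff by blast
  show ?R
  proof (cases a)
    case Nil
    then have "j \<noteq> 1" using p by auto
    then obtain k where k: "j = Suc (Suc k)" using j by (cases j; cases "j - 1") auto
    then have "x @ D # y = unit_path k @ D # b" using p Nil by (simp add: unit_path_Suc_Suc)
    then have "x = unit_path k" using first_return_unique[OF x mot_unit_path] by blast
    then show ?thesis using k a Nil by simp
  next
    case (Cons s a')
    then have p': "x @ D # y = a' @ unit_path j @ b" using p by simp
    show ?thesis
    proof (cases "length x < length a'")
      case True
      then obtain a'' where "a' = x @ D # a''" "y = a'' @ unit_path j @ b"
        using p' by (auto simp: append_eq_append_conv2 Cons_eq_append_conv append_eq_Cons_conv)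
      then have "i = length x + 2 + length a''" "unit_segment y (length a'') j"
        using Cons a j unfolding unit_segment_iff by auto
      then show ?thesis by blast
    next
      case False
      define x' where "x' = drop (length a') x"
      have "take (length a') x = a'" using arg_cong[OF p', of "take (length a')"] False by simp
      then have x': "x = a' @ x'" "x' @ D # y = unit_path j @ b"
        using arg_cong[OF p', of "drop (length a')"] append_take_drop_id[of "length a'" x] False
        by (simp_all add: x'_def)
      \<comment> \<open>\<open>a'\<close> ends at height at least 0 within \<open>x\<close>, so
        \<open>x'\<close> ends at or below its own starting height, and a following \<open>D\<close>
        would be negative for the unit path.\<close>
      have "length (unit_path j) \<le> length x'"
      proof (rule ccontr)
        assume "\<not> length (unit_path j) \<le> length x'"
        then obtain u where "x' @ D # u = unit_path j"
          using x'(2) by (auto simp: append_eq_append_conv2 Cons_eq_append_conv append_eq_Cons_conv)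
        then have u: "unit_path j = x' @ D # u" by simp
        have "0 \<le> height a' (length a')"
          using mot_height_nonneg[OF x, of "length a'"] x'(1) by simp
        moreover have "height a' (length a') + height x' (length x') = 0"
          using mot_height_length[OF x] x'(1) by simp
        moreover have "0 \<le> height (unit_path j) (length x' + Suc 0)"
          by (rule mot_height_nonneg[OF mot_unit_path]) (simp add: u)
        then have "0 \<le> height x' (length x') - 1"
          unfolding u height_append_right by simp
        ultimately show False by simp
      qed
      then have "take j x' = unit_path j" using arg_cong[OF x'(2), of "take j"] by simp
      then obtain x'' where "x' = unit_path j @ x''" by (metis append_take_drop_id)
      then have "unit_segment x (length a') j" using x'(1) j unfolding unit_segment_iff by blast
      then show ?thesis using Cons a by auto
    qed
  qed
next
  assume ?R
  then show ?L
  proof (elim disjE exE conjE)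
    assume *: "i = 0" "j = length x + 2" "x = unit_path (length x)"
    have "U # x @ D # y = [] @ unit_path j @ y"
      using *(3) unit_path_Suc_Suc[of "length x"] *(2) by simp
    then show ?L using * unfolding unit_segment_iff by fastforce
  next
    fix i' assume "i = Suc i'" "unit_segment x i' j"
    then show ?L using unit_segment_shift[of x i' j "[U]" "D # y"] by simp
  next
    fix i' assume "i = length x + 2 + i'" "unit_segment y i' j"
    then show ?L using unit_segment_shift[of y i' j "U # x @ [D]" "[]"] by simp
  qed
qed

lemma unit_segment_unit_path: "unit_segment (unit_path J) i j \<longleftrightarrow> 1 \<le> j \<and> J = j + 2 * i"
proof (induction J arbitrary: i rule: induct_nat_012)
  case 0
  then show ?case by (auto simp: unit_segment_def)
next
  case 1
  show ?case
    by (cases "j = 1") (auto simp: unit_segment_def)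
next
  case (ge2 J)
  have "unit_segment (unit_path (Suc (Suc J))) i j \<longleftrightarrow> i = 0 \<and> j = J + 2 \<or> (\<exists>i'. i = Suc i' \<and> 1 \<le> j \<and> J = j + 2 * i')"
    unfolding unit_path_Suc_Suc unit_segment_split[OF mot_unit_path] ge2.IH(1)
    by (auto simp: unit_segment_def)
  then show ?case by (cases i) auto
qed

lemma height_unit_path: "k \<le> j \<Longrightarrow> height (unit_path j) k = int (min k (j - k))"
proof (induction j arbitrary: k rule: induct_nat_012)
  case 1
  then show ?case by (cases k) auto
next
  case (ge2 j)
  show ?case
  proof (cases k)
    case (Suc l)
    show ?thesis
    proof (cases "l \<le> j")
      case True
      then show ?thesis using Suc ge2.IH(1)[of l] by (simp add: unit_path_Suc_Suc height_append_left Suc_diff_le)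
    next
      case False
      then have "k = length (unit_path (Suc (Suc j)))" using Suc ge2.prems by simp
      then show ?thesis using mot_height_length[OF mot_unit_path[of "Suc (Suc j)"]] by simp
    qed
  qed simp
qed simp

lemma height_unit_segment:
  assumes "unit_segment p i j" "k \<le> j"
  shows "height p (i + k) = height p i + int (min k (j - k))"
proof -
  obtain a b where p: "p = a @ unit_path j @ b" "length a = i"
    using assms(1) unfolding unit_segment_iff by blast
  have "height p (i + k) = height a i + height (unit_path j) k"
    unfolding p(1) p(2)[symmetric] height_append_right using assms(2) by (simp add: height_append_left)
  moreover have "height p i = height a i" unfolding p(1) using p(2) by (simp add: height_append_left)
  ultimately show ?thesis using height_unit_path[OF assms(2)] by simp
qed

section \<open>The topmost points of a unit segment\<close>

lemma sort_key_lex_sorted: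
  fixes f :: "'a :: linorder \<Rightarrow> 'b :: linorder"
  assumes "sorted_wrt (<) xs"
  shows "sorted_wrt (\<lambda>x y. f x < f y \<or> f x = f y \<and> x < y) (sort_key f xs)"
proof -
  let ?R = "\<lambda>x y. f x < f y \<or> f x = f y \<and> x < y"
  have ins: "sorted_wrt ?R (insort_key f x ys)" if "sorted_wrt ?R ys" "\<forall>y\<in>set ys. x < y" for x ys
    using that by (induction ys) (auto simp: set_insort_key not_le)
  show ?thesis using assms by (induction xs) (auto intro!: ins)
qed

lemma set_take_sort_key:
  fixes f :: "'a :: linorder \<Rightarrow> 'b :: linorder"
  assumes xs: "sorted_wrt (<) xs" and A: "A \<subseteq> set xs" "card A = r"
    and lower: "\<And>x y. x \<in> A \<Longrightarrow> y \<in> set xs \<Longrightarrow> y \<notin> A \<Longrightarrow> f x < f y \<or> f x = f y \<and> x < y"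
  shows "set (take r (sort_key f xs)) = A"
proof -
  let ?ys = "sort_key f xs"
  have fin: "finite A" using A(1) by (rule finite_subset) simp
  have dist: "distinct ?ys" using xs by (simp add: strict_sorted_iff)
  have "r \<le> length ?ys" using card_mono[OF _ A(1)] A(2) card_length[of xs] by simp
  then have card: "card (set (take r ?ys)) = card A"
    using distinct_card[OF distinct_take[OF dist, of r]] A(2) by simp
  have "A \<subseteq> set (take r ?ys)"
  proof (rule ccontr)
    assume "\<not> A \<subseteq> set (take r ?ys)"
    then obtain a where a: "a \<in> A" "a \<notin> set (take r ?ys)" by blast
    then have "\<not> set (take r ?ys) \<subseteq> A" using card card_subset_eq[OF fin] by blast
    then obtain b where b: "b \<in> set (take r ?ys)" "b \<notin> A" by blast
    have "set ?ys = set (take r ?ys) \<union> set (drop r ?ys)" by (metis append_take_drop_id set_append)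
    then have "a \<in> set (drop r ?ys)" using a A(1) by auto
    moreover have "sorted_wrt (\<lambda>x y. f x < f y \<or> f x = f y \<and> x < y) (take r ?ys @ drop r ?ys)"
      using sort_key_lex_sorted[OF xs, of f] by simp
    ultimately have "f b < f a \<or> f b = f a \<and> b < a"
      using b(1) unfolding sorted_wrt_append by blast
    moreover have "f a < f b \<or> f a = f b \<and> a < b"
      using lower[OF a(1) _ b(2)] in_set_takeD[OF b(1)] by simp
    ultimately show False by auto
  qed
  then show ?thesis using card_subset_eq[OF _ _ card[symmetric]] by simp
qed

text \<open>Of the j + 1 points, j + 1 - r stay unmarked, equally many at either end because heights
  are symmetric. If their number is odd, the extra one lies on the right, since ties favour the
  left; hence the rounding down.\<close>

lemma set_take_sort_unit_segment:
  assumes seg: "unit_segment p i j" and r: "r \<le> j"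
  shows "set (take r (sort_key (\<lambda>x. - height p x) [i..<Suc (i + j)])) =
    {i + (j + 1 - r) div 2 ..< i + (j + 1 - r) div 2 + r}"
proof (rule set_take_sort_key)
  define s where "s = (j + 1 - r) div 2"
  then have s: "2 * s \<le> j + 1 - r" "j + 1 - r \<le> 2 * s + 1" by simp_all
  show "sorted_wrt (<) [i..<Suc (i + j)]" by (rule sorted_wrt_upt)
  show "{i + (j + 1 - r) div 2 ..< i + (j + 1 - r) div 2 + r} \<subseteq> set [i..<Suc (i + j)]"
    using r s unfolding s_def[symmetric] by auto
  show "card {i + (j + 1 - r) div 2 ..< i + (j + 1 - r) div 2 + r} = r" by simp
  fix x y
  assume x: "x \<in> {i + (j + 1 - r) div 2 ..< i + (j + 1 - r) div 2 + r}"
    and y: "y \<in> set [i..<Suc (i + j)]" "y \<notin> {i + (j + 1 - r) div 2 ..< i + (j + 1 - r) div 2 + r}"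
  obtain k where k: "x = i + k" "s \<le> k" "k < s + r"
    using x that[of "x - i"] unfolding s_def[symmetric] by auto
  obtain l where l: "y = i + l" "l \<le> j" using y(1) by (auto simp: le_iff_add less_Suc_eq_le simp del: upt_Suc)
  have l': "l < s \<or> s + r \<le> l" using y(2) l unfolding s_def[symmetric] by auto
  have "k \<le> j" using k s r by linarith
  then have "height p x = height p i + int (min k (j - k))" "height p y = height p i + int (min l (j - l))"
    using height_unit_segment[OF seg] k l by auto
  moreover have "min l (j - l) < min k (j - k) \<or> min l (j - l) = min k (j - k) \<and> k < l"
    using k l l' s r \<open>k \<le> j\<close> by linarith
  ultimately show "- height p x < - height p y \<or> - height p x = - height p y \<and> x < y"
    using k(1) l(1) by auto
qed

text \<open>The \<open>r\<close> topmost points of a unit path longer than \<open>r\<close> (left before right) are the first \<open>r\<close>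
  points after the starting point of its central unit path of length \<open>r + 1\<close> or \<open>r + 2\<close>,
  whichever has the right parity.\<close>

definition in_unit_top :: "nat \<Rightarrow> path \<Rightarrow> nat \<Rightarrow> bool" where
  "in_unit_top r p k \<longleftrightarrow> (\<exists>i. (unit_segment p i (Suc r) \<or> unit_segment p i (Suc (Suc r))) \<and> i < k \<and> k \<le> i + r)"

text \<open>Inside a unit path only the concentric segments are unit paths, so the offset fixes the
  length.\<close>

lemma unit_segment_inner:
  assumes "unit_segment p i' j'" "1 \<le> j" "i' \<le> i" "i + j \<le> i' + j'"
  shows "unit_segment p i j \<longleftrightarrow> j' = j + 2 * (i - i')"
proof -
  have "take j (drop (i - i') (unit_path j')) = take j (drop (i - i') (take j' (drop i' p)))"
    using assms(1) by (simp add: unit_segment_def)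
  also have "\<dots> = take j (drop i p)"
    using assms(3,4) by (simp add: drop_take min_def)
  finally have "unit_segment p i j \<longleftrightarrow> unit_segment (unit_path j') (i - i') j"
    using assms unfolding unit_segment_def by auto
  then show ?thesis using assms(2) by (simp add: unit_segment_unit_path)
qed

text \<open>A longest unit segment around the given one is maximal; lengths are bounded by that of
  the path.\<close>

lemma unital_segment_exists:
  assumes "unit_segment p i j"
  shows "\<exists>i' j'. unital_segment p i' j' \<and> i' \<le> i \<and> i + j \<le> i' + j'"
proof -
  define P where "P x \<longleftrightarrow> (case x of (i', j') \<Rightarrow> unit_segment p i' j' \<and> i' \<le> i \<and> i + j \<le> i' + j')" for x
  have "P (i, j)" using assms by (simp add: P_def)
  moreover have "\<forall>x. P x \<longrightarrow> snd x < Suc (length p)" by (auto simp: P_def unit_segment_def)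
  ultimately obtain x where x: "P x" "\<forall>y. P y \<longrightarrow> snd y \<le> snd x"
    using Lattices_Big.ex_has_greatest_nat[of P "(i, j)" snd "Suc (length p)"] by blast
  obtain i' j' where ij: "x = (i', j')" by (cases x)
  have "unital_segment p i' j'"
    unfolding unital_segment_def
  proof (rule conjI; (intro allI impI)?)
    show "unit_segment p i' j'" using x(1) ij by (simp add: P_def)
    fix i'' j'' assume *: "unit_segment p i'' j'' \<and> i'' \<le> i' \<and> i' + j' \<le> i'' + j''"
    then have "P (i'', j'')" using x(1) ij by (auto simp: P_def)
    then have "j'' \<le> j'" using x(2) ij by auto
    then show "i'' = i' \<and> j'' = j'" using * by auto
  qed
  then show ?thesis using x(1) ij by (auto simp: P_def)
qed

text \<open>By \<open>ext\<close> a unit segment of length at most \<open>r\<close> can always be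
  enlarged, so maximal ones are longer than \<open>r\<close> and the description of their top points
  applies. It replaces the maximality condition by a local one, which can be followed along the
  grammar.\<close>

lemma marked_eq_in_unit_top:
  assumes ext: "\<And>i j. unit_segment p i j \<Longrightarrow> j \<le> r \<Longrightarrow> \<exists>i'. i = Suc i' \<and> unit_segment p i' (Suc (Suc j))"
  shows "marked r p = {k. in_unit_top r p k}"
proof -
  have long: "r < j" if u: "unital_segment p i j" for i j
  proof (rule ccontr)
    assume "\<not> r < j"
    then obtain i' where "i = Suc i'" "unit_segment p i' (Suc (Suc j))"
      using ext[of i j] u unfolding unital_segment_def by auto
    then show False using u unfolding unital_segment_def by fastforce
  qed
  have "k \<in> marked r p \<longleftrightarrow> in_unit_top r p k" for k
  proof
    assume "k \<in> marked r p"
    then obtain i j where u: "unital_segment p i j"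
      and k: "k \<in> set (take r (sort_key (\<lambda>x. - height p x) [i..<Suc (i + j)]))"
      unfolding marked_def by blast
    have seg: "unit_segment p i j" and j: "r < j" using u long unital_segment_def by auto
    \<comment> \<open>The number of concentric layers to strip until length r + 1 or r + 2 is
      left.\<close>
    define d where "d = (j - Suc r) div 2"
    have "j + 1 - r = Suc (Suc (j - Suc r))" using j by simp
    then have d: "(j + 1 - r) div 2 = Suc d" unfolding d_def by simp
    have "2 * d \<le> j - Suc r" "j - Suc r \<le> 2 * d + 1" unfolding d_def by simp_all
    then have jd: "j - 2 * d = Suc r \<or> j - 2 * d = Suc (Suc r)" "2 * d \<le> j" using j by linarith+
    have "unit_segment p (i + d) (j - 2 * d)"
      using unit_segment_inner[OF seg, of "j - 2 * d" "i + d"] jd by auto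
    then show "in_unit_top r p k"
      using k jd(1) set_take_sort_unit_segment[OF seg] j unfolding in_unit_top_def d by fastforce
  next
    assume "in_unit_top r p k"
    then obtain i j where seg: "unit_segment p i j" and j: "j = Suc r \<or> j = Suc (Suc r)" and k: "i < k" "k \<le> i + r"
      unfolding in_unit_top_def by blast
    obtain i' j' where u: "unital_segment p i' j'" and le: "i' \<le> i" "i + j \<le> i' + j'"
      using unital_segment_exists[OF seg] by blast
    have seg': "unit_segment p i' j'" using u unital_segment_def by simp
    have "j' = j + 2 * (i - i')" using unit_segment_inner[OF seg' _ le] seg j by auto
    then have "i' + (j' + 1 - r) div 2 = Suc i" using j le by auto
    then have "k \<in> set (take r (sort_key (\<lambda>x. - height p x) [i'..<Suc (i' + j')]))"
      using set_take_sort_unit_segment[OF seg', of r] long[OF u] k by simp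
    then show "k \<in> marked r p" using u unfolding marked_def by blast
  qed
  then show ?thesis by blast
qed

lemma unit_segment_ext_split:
  assumes x: "mot x" and seg: "unit_segment (U # x @ D # y) i j" and j: "j < length x + 2"
    and hx: "\<And>i. unit_segment x i j \<Longrightarrow> unit_segment (U # x @ D # y) i (Suc (Suc j))"
    and hy: "\<And>i. unit_segment y i j \<Longrightarrow> \<exists>i'. i = Suc i' \<and> unit_segment y i' (Suc (Suc j))"
  shows "\<exists>i'. i = Suc i' \<and> unit_segment (U # x @ D # y) i' (Suc (Suc j))"
proof -
  consider i' where "i = Suc i'" "unit_segment x i' j" |
    i' where "i = length x + 2 + i'" "unit_segment y i' j"
    using seg j unfolding unit_segment_split[OF x] by auto
  then show ?thesis
  proof cases
    case 1
    then show ?thesis using hx by blast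
  next
    case 2
    then obtain l where "i' = Suc l" "unit_segment y l (Suc (Suc j))" using hy by blast
    then have "i = Suc (length x + 2 + l)" "unit_segment (U # x @ D # y) (length x + 2 + l) (Suc (Suc j))"
      using 2 unfolding unit_segment_split[OF x] by auto
    then show ?thesis by blast
  qed
qed

lemma unit_segment_unit_path_ext:
  assumes "unit_segment (unit_path J) i j"
  shows "unit_segment (U # unit_path J @ D # y) i (Suc (Suc j))"
  using assms unfolding unit_segment_split[OF mot_unit_path] unit_segment_unit_path
  by (cases i) auto

text \<open>The parts sum to the length, and one of them exceeds \<open>r\<close>. So a
  \<open>UD\<close> block is longer than r + 2 and cannot be confused with the blocks u^(r+1) and
  u^(r+2).\<close>

lemma length_UD_gt:
  assumes "1 \<le> r" "word r v" "\<exists>t\<in>set v. t \<noteq> unit_path r"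
  shows "r < length (concat v)"
proof -
  have ne: "parts (concat (drop_units r v)) \<noteq> {#}" using parts_UD_nonempty assms by blast
  have "r < max_part (parts (concat (drop_units r v)))" using parts_drop_units_gt[OF assms(1,2)] max_part_in[OF ne] by blast
  also have "\<dots> \<le> max_part (parts (concat v))" using parts_word[OF assms(1,2)] by simp
  also have "\<dots> \<le> sum_mset (parts (concat v))"
    using max_part_in[of "parts (concat v)"] by (cases "parts (concat v) = {#}") (auto dest: sum_mset.remove)
  also have "\<dots> = length (concat v)" using sum_parts word_mot assms(2) by blast
  finally show ?thesis .
qed

text \<open>Supplies the hypothesis of \<open>marked_eq_in_unit_top\<close>. Without tokens u^(r),
  an innermost block is u^(r+1) or u^(r+2), and a short unit segment sits concentrically in one of
  these with room for another layer.\<close>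

lemma word_unit_segment_ext:
  "1 \<le> r \<Longrightarrow> word r w \<Longrightarrow> unit_path r \<notin> set w \<Longrightarrow> unit_segment (concat w) i j \<Longrightarrow> j \<le> r \<Longrightarrow>
    \<exists>i'. i = Suc i' \<and> unit_segment (concat w) i' (Suc (Suc j))"
proof (rotate_tac, induction arbitrary: i rule: word.induct)
  case Nil
  then show ?case by (auto simp: unit_segment_def)
next
  case (Z w)
  then show ?case by simp
next
  case (X w)
  obtain s where s: "r = Suc s" using X.prems by (cases r) auto
  have c: "concat (unit_path (Suc r) # w) = U # unit_path s @ D # concat w"
    by (simp add: s unit_path_Suc_Suc)
  show ?case unfolding c
  proof (rule unit_segment_ext_split[OF mot_unit_path])
    show "unit_segment (U # unit_path s @ D # concat w) i j" using X.prems c by metis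
    show "j < length (unit_path s) + 2" using X.prems s by simp
    show "\<exists>i'. i = Suc i' \<and> unit_segment (concat w) i' (Suc (Suc j))" if "unit_segment (concat w) i j" for i
      using X.IH that X.prems by simp
  qed (rule unit_segment_unit_path_ext)
next
  case (Y w c)
  \<comment> \<open>With no separate copies left the block is U u^(r) D, that is, u^(r+2).\<close>
  then have "c = 0" by auto
  then have c: "concat ((U # unit_path r) # replicate c (unit_path r) @ [D] # w) = U # unit_path r @ D # concat w"
    by simp
  show ?case unfolding c
  proof (rule unit_segment_ext_split[OF mot_unit_path])
    show "unit_segment (U # unit_path r @ D # concat w) i j" using Y.prems c by metis
    show "j < length (unit_path r) + 2" using Y.prems by simp
    show "\<exists>i'. i = Suc i' \<and> unit_segment (concat w) i' (Suc (Suc j))" if "unit_segment (concat w) i j" for i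
      using Y.IH that Y.prems by simp
  qed (rule unit_segment_unit_path_ext)
next
  case (UD v w)
  have c: "concat ([U] # v @ [D] # w) = U # concat v @ D # concat w" by simp
  have m: "mot (concat v)" using UD.hyps word_mot by blast
  show ?case unfolding c
  proof (rule unit_segment_ext_split[OF m])
    show "unit_segment (U # concat v @ D # concat w) i j" using UD.prems c by metis
    show "j < length (concat v) + 2" using UD.prems length_UD_gt[OF _ UD.hyps(1,3)] by simp
    show "unit_segment (U # concat v @ D # concat w) i (Suc (Suc j))" if seg: "unit_segment (concat v) i j" for i
    proof -
      obtain l where "i = Suc l" "unit_segment (concat v) l (Suc (Suc j))"
        using UD.IH(1)[of i] seg UD.prems by auto
      then show ?thesis unfolding unit_segment_split[OF m] by blast
    qed
    show "\<exists>i'. i = Suc i' \<and> unit_segment (concat w) i' (Suc (Suc j))" if "unit_segment (concat w) i j" for i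
      using UD.IH(2) that UD.prems by simp
  qed
qed

subsection \<open>The bijection\<close>

lemma zero_in_free_points: "0 \<in> set (free_points r {#} ts)"
  by (cases ts) auto

lemma set_free_points_append:
  "set (free_points r {#} (xs @ ys)) = set (free_points r {#} xs) \<union> (+) (length (concat xs)) ` set (free_points r {#} ys)"
  by (induction xs) (auto simp: zero_in_free_points insert_absorb image_Un image_image add.assoc)

lemma sorted_free_points: "[] \<notin> set ts \<Longrightarrow> sorted_wrt (<) (free_points r {#} ts)"
  by (induction ts) (auto simp: sorted_wrt_map)

lemma in_unit_top_bounds: "in_unit_top r p k \<Longrightarrow> 0 < k \<and> k < length p"
  unfolding in_unit_top_def unit_segment_def by auto

text \<open>The first alternative is the case where the block as a whole is u^(r+2) or u^(r+1); its
  top then consists of the points 1 to \<open>r\<close>.\<close>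

lemma in_unit_top_split:
  assumes "mot x"
  shows "in_unit_top r (U # x @ D # y) k \<longleftrightarrow>
    x = unit_path (length x) \<and> (length x = r \<or> Suc (length x) = r) \<and> 1 \<le> k \<and> k \<le> r \<or>
    (\<exists>k'. k = Suc k' \<and> in_unit_top r x k') \<or> (\<exists>k'. k = length x + 2 + k' \<and> in_unit_top r y k')" (is "?L \<longleftrightarrow> ?R")
proof
  assume ?L
  then obtain i j where j: "j = Suc r \<or> j = Suc (Suc r)" and seg: "unit_segment (U # x @ D # y) i j"
    and k: "i < k" "k \<le> i + r" unfolding in_unit_top_def by blast
  from seg show ?R
    unfolding unit_segment_split[OF assms]
  proof (elim disjE exE conjE)
    assume "i = 0" "j = length x + 2" "x = unit_path (length x)"
    then show ?R using j k by auto
  next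
    fix i' assume "i = Suc i'" "unit_segment x i' j"
    then have "k = Suc (k - 1)" "in_unit_top r x (k - 1)" using j k unfolding in_unit_top_def by auto
    then show ?R by blast
  next
    fix i' assume i': "i = length x + 2 + i'" "unit_segment y i' j"
    then have "k = length x + 2 + (k - (length x + 2))" "i' < k - (length x + 2)" "k - (length x + 2) \<le> i' + r"
      using k by linarith+
    moreover have "in_unit_top r y (k - (length x + 2))" using calculation j i' unfolding in_unit_top_def by blast
    ultimately show ?R by blast
  qed
next
  assume ?R
  then show ?L
  proof (elim disjE exE conjE)
    assume "x = unit_path (length x)" "length x = r" "1 \<le> k" "k \<le> r"
    then show ?L unfolding in_unit_top_def unit_segment_split[OF assms] by (intro exI[of _ 0]) auto
  next
    assume "x = unit_path (length x)" "Suc (length x) = r" "1 \<le> k" "k \<le> r"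
    then show ?L unfolding in_unit_top_def unit_segment_split[OF assms] by (intro exI[of _ 0]) auto
  next
    fix k' assume "k = Suc k'" "in_unit_top r x k'"
    then obtain i where "unit_segment x i (Suc r) \<or> unit_segment x i (Suc (Suc r))" "i < k'" "k' \<le> i + r"
      unfolding in_unit_top_def by blast
    then show ?L using \<open>k = Suc k'\<close> unfolding in_unit_top_def unit_segment_split[OF assms]
      by (intro exI[of _ "Suc i"]) auto
  next
    fix k' assume "k = length x + 2 + k'" "in_unit_top r y k'"
    then obtain i where "unit_segment y i (Suc r) \<or> unit_segment y i (Suc (Suc r))" "i < k'" "k' \<le> i + r"
      unfolding in_unit_top_def by blast
    then show ?L using \<open>k = length x + 2 + k'\<close> unfolding in_unit_top_def unit_segment_split[OF assms]
      by (intro exI[of _ "length x + 2 + i"]) auto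
  qed
qed

lemma not_in_unit_top_unit_path: "J \<le> r \<Longrightarrow> \<not> in_unit_top r (unit_path J) k"
  unfolding in_unit_top_def unit_segment_unit_path by auto

text \<open>The points strictly inside tokens are the top points: u^(r+1) and the fused token U
  u^(r) both have inner points 1 to \<open>r\<close>, and \<open>U\<close>, \<open>D\<close> have
  none. In u^(r+2) the point r + 1 before the last \<open>D\<close> stays free, which is why the
  block is cut into U u^(r) and \<open>D\<close>.\<close>

lemma free_points_iff_not_in_unit_top:
  "1 \<le> r \<Longrightarrow> word r w \<Longrightarrow> unit_path r \<notin> set w \<Longrightarrow>
    k \<in> set (free_points r {#} w) \<longleftrightarrow> k \<le> length (concat w) \<and> \<not> in_unit_top r (concat w) k"
proof (rotate_tac, induction arbitrary: k rule: word.induct)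
  case Nil
  then show ?case by (auto dest: in_unit_top_bounds)
next
  case (Z w)
  then show ?case by simp
next
  case (X w)
  obtain s where s: "r = Suc s" using X.prems by (cases r) auto
  have c: "concat (unit_path (Suc r) # w) = U # unit_path s @ D # concat w"
    by (simp add: s unit_path_Suc_Suc)
  have IH: "l \<in> set (free_points r {#} w) \<longleftrightarrow> l \<le> length (concat w) \<and> \<not> in_unit_top r (concat w) l" for l
    using X by simp
  have t: "in_unit_top r (U # unit_path s @ D # concat w) k \<longleftrightarrow>
      1 \<le> k \<and> k \<le> r \<or> (\<exists>l. k = Suc r + l \<and> in_unit_top r (concat w) l)"
    unfolding in_unit_top_split[OF mot_unit_path] using s by (auto simp: not_in_unit_top_unit_path)
  have m: "k \<in> set (free_points r {#} (unit_path (Suc r) # w)) \<longleftrightarrow> k = 0 \<or> (\<exists>l. k = Suc r + l \<and> l \<in> set (free_points r {#} w))"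
    by auto
  consider "k = 0" | "1 \<le> k" "k \<le> r" | l where "k = Suc r + l"
    by (metis One_nat_def Suc_leI le_Suc_ex not_less_eq_eq not_gr_zero)
  then show ?case unfolding m c t IH using s by cases auto
next
  case (Y w c)
  then have c0: "c = 0" by auto
  then have c: "concat ((U # unit_path r) # replicate c (unit_path r) @ [D] # w) = U # unit_path r @ D # concat w"
    by simp
  have IH: "l \<in> set (free_points r {#} w) \<longleftrightarrow> l \<le> length (concat w) \<and> \<not> in_unit_top r (concat w) l" for l
    using Y by simp
  have t: "in_unit_top r (U # unit_path r @ D # concat w) k \<longleftrightarrow>
      1 \<le> k \<and> k \<le> r \<or> (\<exists>l. k = r + 2 + l \<and> in_unit_top r (concat w) l)"
    unfolding in_unit_top_split[OF mot_unit_path] by (auto simp: not_in_unit_top_unit_path)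
  have m: "k \<in> set (free_points r {#} ((U # unit_path r) # replicate c (unit_path r) @ [D] # w)) \<longleftrightarrow>
      k = 0 \<or> k = Suc r \<or> (\<exists>l. k = r + 2 + l \<and> l \<in> set (free_points r {#} w))"
    using c0 by auto
  consider "k = 0" | "1 \<le> k" "k \<le> r" | "k = Suc r" | l where "k = r + 2 + l"
    by (metis One_nat_def Suc_leI add_2_eq_Suc' add_Suc_right le_Suc_ex not_less_eq_eq not_gr_zero le_antisym)
  then show ?case unfolding m c t IH by cases auto
next
  case (UD v w)
  have c: "concat ([U] # v @ [D] # w) = U # concat v @ D # concat w" by simp
  have mv: "mot (concat v)" using UD.hyps word_mot by blast
  have len: "r < length (concat v)" using length_UD_gt UD.hyps UD.prems by blast
  have IHv: "l \<in> set (free_points r {#} v) \<longleftrightarrow> l \<le> length (concat v) \<and> \<not> in_unit_top r (concat v) l" for l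
    using UD by simp
  have IHw: "l \<in> set (free_points r {#} w) \<longleftrightarrow> l \<le> length (concat w) \<and> \<not> in_unit_top r (concat w) l" for l
    using UD by simp
  have t: "in_unit_top r (U # concat v @ D # concat w) k \<longleftrightarrow>
      (\<exists>l. k = Suc l \<and> in_unit_top r (concat v) l) \<or> (\<exists>l. k = length (concat v) + 2 + l \<and> in_unit_top r (concat w) l)"
    unfolding in_unit_top_split[OF mv] using len by auto
  have "set (free_points r {#} ([U] # v @ [D] # w)) = insert 0 (Suc ` set (free_points r {#} v) \<union>
      (\<lambda>l. length (concat v) + 2 + l) ` set (free_points r {#} w) \<union> {Suc (length (concat v))})"
    by (auto simp: set_free_points_append image_Un image_image)
  \<comment> \<open>The boundary before the closing \<open>D\<close> is the end point of the inner
    path and already counted there.\<close>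
  moreover have "Suc (length (concat v)) \<in> Suc ` set (free_points r {#} v)"
    using IHv in_unit_top_bounds by blast
  ultimately have m: "k \<in> set (free_points r {#} ([U] # v @ [D] # w)) \<longleftrightarrow> k = 0 \<or>
      (\<exists>l. k = Suc l \<and> l \<in> set (free_points r {#} v)) \<or> (\<exists>l. k = length (concat v) + 2 + l \<and> l \<in> set (free_points r {#} w))"
    by auto
  consider "k = 0" | l where "k = Suc l" "l \<le> length (concat v)" | l where "k = length (concat v) + 2 + l"
    by (metis add_2_eq_Suc' add_Suc le_Suc_ex not_less_eq_eq old.nat.exhaust)
  then show ?case
  proof cases
    case 1
    then show ?thesis unfolding m c t by simp
  next
    case (2 l)
    then show ?thesis unfolding m c t IHv IHw by auto
  next
    case (3 l)
    then have "k = Suc l' \<Longrightarrow> \<not> in_unit_top r (concat v) l' \<and> \<not> l' \<le> length (concat v)" for l'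
      using in_unit_top_bounds[of r "concat v" l'] by auto
    then show ?thesis unfolding m c t IHv IHw using 3 by auto
  qed
qed

lemma word_tokens_nonempty: "1 \<le> r \<Longrightarrow> word r w \<Longrightarrow> [] \<notin> set w"
  by (rotate_tac, induction rule: word.induct) (auto simp: eq_commute[of "[]"])

lemma labeled_points_word:
  assumes "1 \<le> r" "word r w" "unit_path r \<notin> set w"
  shows "labeled_points r (concat w) = rev (free_points r {#} w)"
proof -
  have "marked r (concat w) = {k. in_unit_top r (concat w) k}"
    using word_unit_segment_ext[OF assms] by (intro marked_eq_in_unit_top) blast
  then have "set (filter (\<lambda>k. k \<notin> marked r (concat w)) [0..<Suc (length (concat w))]) = set (free_points r {#} w)"
    using free_points_iff_not_in_unit_top[OF assms] by (auto simp: less_Suc_eq_le simp del: upt_Suc)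
  moreover have "sorted_wrt (<) (filter (\<lambda>k. k \<notin> marked r (concat w)) [0..<Suc (length (concat w))])"
    by (intro sorted_wrt_filter sorted_wrt_upt)
  ultimately have "filter (\<lambda>k. k \<notin> marked r (concat w)) [0..<Suc (length (concat w))] = free_points r {#} w"
    using sorted_free_points[OF word_tokens_nonempty[OF assms(1,2)]] by (metis strict_sorted_equal)
  then show ?thesis unfolding labeled_points_def by simp
qed

text \<open>Unique factorisation carries the claim over to words: the source consists of words of
  \<open>n\<close> tokens without u^(r), the target of words with exactly \<open>m\<close> tokens
  u^(r), and deleting these tokens while recording their gaps inverts the insertion.\<close>

lemma bij_betw_psi_parts:
  assumes r: "1 \<le> r" and S: "\<forall>x\<in>#S. r < x" and n: "sum_mset S = r * size S + n"
  shows "bij_betw (psi r) (seqs n m \<times> {p. mot p \<and> parts p = S})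
    {p. mot p \<and> parts p = S + replicate_mset m r}"
proof -
  have drop_units: "drop_units r w = w" if "unit_path r \<notin> set w" for w
    using that by (auto simp: filter_id_conv)
  have count: "filter_mset (\<lambda>x. r < x) (parts (concat (drop_units r w))) = parts (concat (drop_units r w))"
    if "word r w" for w
    using parts_drop_units_gt[OF r that] by (simp add: filter_mset_eq_conv)
  \<comment> \<open>The members of \<open>S\<close> exceed \<open>r\<close>, so filtering by size
    separates them from the copies of \<open>r\<close>.\<close>
  have inv: "parts (concat (drop_units r w)) = S \<and> count_list w (unit_path r) = k"
    if "word r w" "parts (concat w) = S + replicate_mset k r" for w k
  proof -
    have eq: "parts (concat (drop_units r w)) + replicate_mset (count_list w (unit_path r)) r = S + replicate_mset k r"
      using parts_word[OF r that(1)] that(2) by simp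
    have rep: "filter_mset (\<lambda>x. r < x) (replicate_mset l r) = {#}" for l by (induction l) auto
    have "filter_mset (\<lambda>x. r < x) S = S" using S by (simp add: filter_mset_eq_conv)
    then have "parts (concat (drop_units r w)) = S"
      using arg_cong[OF eq, of "filter_mset (\<lambda>x. r < x)"]
      by (simp only: filter_union_mset rep count[OF that(1)] empty_neutral)
    then show ?thesis using eq by (auto simp: replicate_mset_eq_iff)
  qed
  \<comment> \<open>With \<open>n\<close> tokens there are n + 1 boundaries, labelled 0 to
    \<open>n\<close>.\<close>
  have len: "length w = n" if "word r w" "unit_path r \<notin> set w" "parts (concat w) = S" for w
    using length_word[OF r that(1,2)] sum_parts[OF word_mot[OF that(1)]] that(3) n by simp
  have dom: "\<exists>w. word r w \<and> unit_path r \<notin> set w \<and> concat w = p" if p: "mot p" "parts p = S" for p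
  proof -
    have "\<forall>x\<in>#parts p. r \<le> x" using S p(2) by auto
    then obtain w where w: "word r w" "concat w = p" using word_exists[OF r p(1)] by blast
    then have "count_list w (unit_path r) = 0" using inv[of w 0] p(2) by simp
    then show ?thesis using w by (auto simp: count_list_0_iff)
  qed
  have psi: "psi r (as, concat w) = concat (insert_units r (mset as) w)"
    and word: "word r (insert_units r (mset as) w)"
    if "word r w" "unit_path r \<notin> set w" "parts (concat w) = S" "as \<in> seqs n m" for as w
  proof -
    have "\<forall>t\<in>set w. t \<noteq> []" using word_tokens_nonempty[OF r that(1)] by blast
    moreover have "\<forall>a\<in>set as. a \<le> length w" using that(4) len[OF that(1-3)] by (simp add: seqs_def)
    ultimately show "psi r (as, concat w) = concat (insert_units r (mset as) w)"
      using labeled_points_word[OF r that(1,2)] by (intro psi_eq)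
    show "word r (insert_units r (mset as) w)" by (rule word_of_drop_units[OF that(1) drop_units_insert_units[OF that(2)]])
  qed
  show ?thesis
    unfolding bij_betw_def
  proof
    show "inj_on (psi r) (seqs n m \<times> {p. mot p \<and> parts p = S})"
    proof (rule inj_onI, clarify)
      fix as p as' p'
      assume as: "as \<in> seqs n m" "as' \<in> seqs n m" and p: "mot p" "mot p'" "parts p' = parts p" "S = parts p"
        and eq: "psi r (as, p) = psi r (as', p')"
      obtain w where w: "word r w" "unit_path r \<notin> set w" "concat w = p" using dom p by metis
      obtain w' where w': "word r w'" "unit_path r \<notin> set w'" "concat w' = p'" using dom p by metis
      have iw: "insert_units r (mset as) w = insert_units r (mset as') w'"
        using word_unique[OF r word word] eq psi w w' as p by metis
      then have ww: "w = w'" using drop_units_insert_units[OF w(2)] drop_units_insert_units[OF w'(2)] by metis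
      have "count (mset as) a = count (mset as') a" for a
      proof (cases "a \<le> n")
        case True
        then show ?thesis using insert_units_inj[OF w(2)] iw ww len[OF w(1,2)] w(3) p(4) by metis
      next
        case False
        then have "a \<notin> set as" "a \<notin> set as'" using as by (auto simp: seqs_def)
        then show ?thesis by (metis count_mset_0_iff)
      qed
      then have "mset as = mset as'" by (rule multiset_eqI)
      \<comment> \<open>A weakly increasing sequence is determined by its multiset of
        entries.\<close>
      then have "as = as'" using as unfolding seqs_def by (metis (mono_tags, lifting) mem_Collect_eq properties_for_sort sorted_sort_id)
      then show "as = as' \<and> p = p'" using ww w w' by simp
    qed
    show "psi r ` (seqs n m \<times> {p. mot p \<and> parts p = S}) = {p. mot p \<and> parts p = S + replicate_mset m r}"
    proof (intro equalityI subsetI; clarify)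
      fix as p assume as: "as \<in> seqs n m" and p: "mot p" "S = parts p"
      obtain w where w: "word r w" "unit_path r \<notin> set w" "concat w = p" using dom p by metis
      have "set_mset (mset as) \<subseteq> {..length w}" "size (mset as) = m"
        using as len[OF w(1,2)] w(3) p(2) by (auto simp: seqs_def)
      then have "count_list (insert_units r (mset as) w) (unit_path r) = m" using count_list_insert_units[OF w(2)] by simp
      then show "mot (psi r (as, p)) \<and> parts (psi r (as, p)) = parts p + replicate_mset m r"
        using psi[OF w(1,2) _ as] word[OF w(1,2) _ as] w(3) p(2)
          parts_word[OF r, of "insert_units r (mset as) w"] drop_units_insert_units[OF w(2)] word_mot by simp
    next
      fix p' assume p': "mot p'" "parts p' = S + replicate_mset m r"
      then have "\<forall>x\<in>#parts p'. r \<le> x" using S by (auto split: if_splits)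
      then obtain w' where w': "word r w'" "concat w' = p'" using word_exists[OF r p'(1)] by blast
      define w where "w = drop_units r w'"
      have w: "word r w" "unit_path r \<notin> set w" unfolding w_def using word_drop_units[OF w'(1)] by auto
      have pw: "parts (concat w) = S" and c: "count_list w' (unit_path r) = m"
        using inv[OF w'(1)] w'(2) p'(2) unfolding w_def by auto
      obtain A where A: "set_mset A \<subseteq> {..length w}" "w' = insert_units r A w"
        using insert_units_surj[of r w'] unfolding w_def by blast
      have "size A = m" using count_list_insert_units[OF w(2) A(1)] A(2) c by simp
      then have as: "sorted_list_of_multiset A \<in> seqs n m"
        using A(1) len[OF w pw] unfolding seqs_def
        by (auto simp flip: size_mset)
      have "psi r (sorted_list_of_multiset A, concat w) = p'"
        using psi[OF w pw as] A(2) w'(2) by simp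
      then show "p' \<in> psi r ` (seqs n m \<times> {p. mot p \<and> parts p = S})"
        using as word_mot[OF w(1)] pw by force
    qed
  qed
qed

theorem theorem3p5:
  fixes r m n :: nat and lam mu lam' :: "nat list"
  assumes "1 \<le> r"
    and "is_partition lam" and "lam \<noteq> []"
    and "mu = conjugate lam"
    and "mu ! (hd lam - 1) > r"
    and "n = sum_list (drop r lam)"
    and "lam' = map (\<lambda>x. x + m) (take r lam) @ drop r lam"
  shows "bij_betw (psi r) (seqs n m \<times> motzkin_of_shape lam) (motzkin_of_shape lam')"
proof -
  have last: "r < conjugate lam ! (hd lam - 1)" using assms(4,5) by simp
  note cols = conjugate_add_columns[OF assms(2,3,1) last assms(7)]
  \<comment> \<open>The number of parts is \<open>hd lam\<close>, and the first \<open>r\<close>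
    rows, all of this length, account for the product.\<close>
  have "sum_mset (mset mu) = r * size (mset mu) + n"
    using cols(4) assms by (simp add: sum_mset_sum_list sum_list_conjugate length_conjugate)
  moreover have "\<forall>x\<in>#mset mu. r < x" using cols(3) assms(4) by simp
  ultimately have "bij_betw (psi r) (seqs n m \<times> {p. mot p \<and> parts p = mset mu})
      {p. mot p \<and> parts p = mset mu + replicate_mset m r}"
    using bij_betw_psi_parts assms(1) by blast
  then show ?thesis
    using motzkin_of_shape_eq[OF assms(2)] motzkin_of_shape_eq[OF cols(1)] cols(2) assms(4) by simp
qed

end
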